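(* Consider the energy harvesting additive white Gaussian noise (EH-AWGN) channel with noise variance $\sigma^2>0$, infinite energy buffer and harvest-use-store (HUS) architecture, whose energy process $\{Y_i\}_{i\ge1}$ is an i.i.d. sequence of non-negative random variables, distributed as $Y$, with $E[Y^2]<\infty$. Let $0<\varepsilon<1$, and let $M^*(\hat n,\varepsilon)$ denote the maximal size of a code of blocklength $\hat n$ with average error probability at most $\varepsilon$ for this channel. Put $$C_{EG}=\frac12\log_2\left(1+\frac{E[Y]}{\sigma^2}\right),\qquad V_{EG}=\frac{E[Y]}{E[Y]+\sigma^2}.$$ Then for every $a>0$ there is a constant $\hat C\ge 0$ (not depending on $\hat n$) such that, as $\hat n\to\infty$, $$\log M^*(\hat n,\varepsilon)\ \ge\ \hat n\,C_{EG}-\sqrt{\hat n}\,(\log\hat n)^a\,C_{EG}+\sqrt{\frac{\hat n V_{EG}}{2}}\;\Phi^{-1}(\varepsilon)-\frac{\sqrt{\hat n}\,\hat C}{(\log(\hat n/2))^{2a}}-\log\hat n+O(1).$$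
   Context: Logarithms $\log$ are to base 2. $\Phi(x)=\frac{1}{\sqrt{2\pi}}\int_{-\infty}^x e^{-u^2/2}\,du$ is the standard normal distribution function and $\Phi^{-1}$ is its inverse. Channel model. At time $i\ge 1$ the channel input is $X_i\in\mathbb{R}$ and the output is $W_i=X_i+\zeta_i$, where $\{\zeta_i\}_{i\ge 1}$ are i.i.d. normal with mean zero and variance $\sigma^2$. The transmitter is powered by an energy harvesting source with an infinite buffer: $Y_i\ge 0$ is the energy harvested at time $i$, $B_i$ is the energy in the buffer at time $i$ (with the buffer initially empty, $B_1=0$), and sending the symbol $X_i$ uses energy $X_i^2$. Under the HUS architecture the energy harvested at time $i$ may be used at time $i$, so the inputs must satisfy, for every $i$, $$X_i^2\le B_i+Y_i,\qquad B_{i+1}=B_i+Y_i-X_i^2 .$$ Equivalently, $\sum_{j=1}^k X_j^2\le\sum_{j=1}^k Y_j$ for every $k$. The energy process $\{Y_i\}$, the noise $\{\zeta_i\}$ and the message are mutually independent. Codes. A code of blocklength $\hat n$ and size $M$ consists of: a message uniformly distributed on $\{1,\dots,M\}$; encoding functions that determine the input $X_i$, $1\le i\le\hat n$, from the message and the energies $Y_1,\dots,Y_i$ harvested up to time $i$ (causal energy knowledge at the transmitter), such that the energy constraints above hold for all $1\le i\le \hat n$; and a decoder which produces an estimate $\hat M$ of the message from the outputs $(W_1,\dots,W_{\hat n})$ (without knowledge of the energies). Its average error probability is the probability that $\hat M$ differs from the message. $M^*(\hat n,\varepsilon)$ is the largest $M$ for which a code of blocklength $\hat n$ and size $M$ with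 average error probability at most $\varepsilon$ exists. The constant $\hat C$ and the implied constant in $O(1)$ may depend on $\varepsilon$, $a$, $\sigma^2$ and the law of $Y$, but not on $\hat n$. *)

theory Defs
  imports "HOL-Probability.Probability"
begin

definition std_normal_quantile :: "real \<Rightarrow> real" where
  "std_normal_quantile = inv (cdf std_normal_distribution)"

text \<open>Energy in the buffer at time \<open>i\<close> for harvested energies \<open>y\<close> and channel inputs \<open>x\<close>.
  Time starts at \<open>1\<close>; the value at \<open>0\<close> is a dummy.\<close>

fun buffer :: "(nat \<Rightarrow> real) \<Rightarrow> (nat \<Rightarrow> real) \<Rightarrow> nat \<Rightarrow> real" where
  "buffer y x 0 = 0"
| "buffer y x (Suc 0) = 0"
| "buffer y x (Suc (Suc i)) = buffer y x (Suc i) + y (Suc i) - (x (Suc i))\<^sup>2"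

text \<open>An encoder maps a message, a time \<open>i\<close> and the energies harvested at times \<open>1, \<dots>, i\<close>
  to the channel input at time \<open>i\<close>; causality is enforced by the restriction.\<close>

type_synonym encoder = "nat \<Rightarrow> nat \<Rightarrow> (nat \<Rightarrow> real) \<Rightarrow> real"
type_synonym decoder = "(nat \<Rightarrow> real) \<Rightarrow> nat"

definition channel_input :: "encoder \<Rightarrow> nat \<Rightarrow> (nat \<Rightarrow> real) \<Rightarrow> nat \<Rightarrow> real" where
  "channel_input enc m y i = enc m i (restrict y {1..i})"

text \<open>The energy constraint is imposed for every sequence of non-negative energies. Imposing it
  only almost surely gives the same maximal code size: an encoder can be changed to send \<open>0\<close>
  whenever its symbol would violate the constraint.\<close>

definition eh_code :: "nat \<Rightarrow> nat \<Rightarrow> encoder \<Rightarrow> decoder \<Rightarrow> bool" where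
  "eh_code n M enc dec \<longleftrightarrow>
     1 \<le> M \<and>
     (\<forall>m\<in>{1..M}. \<forall>i\<in>{1..n}. enc m i \<in> borel_measurable (\<Pi>\<^sub>M j\<in>{1..i}. borel)) \<and>
     (\<forall>m\<in>{1..M}. \<forall>y. (\<forall>j. 0 \<le> y j) \<longrightarrow>
        (\<forall>i\<in>{1..n}. (channel_input enc m y i)\<^sup>2 \<le> buffer y (channel_input enc m y) i + y i)) \<and>
     dec \<in> measurable (\<Pi>\<^sub>M j\<in>{1..n}. borel) (count_space {1..M})"

text \<open>Joint law of the message, the energies and the noise up to time \<open>n\<close>, where \<open>D\<close> is the law
  of the energy harvested in one time step.\<close>

definition eh_channel_law :: "real measure \<Rightarrow> real \<Rightarrow> nat \<Rightarrow> nat \<Rightarrow>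
    (nat \<times> (nat \<Rightarrow> real) \<times> (nat \<Rightarrow> real)) measure" where
  "eh_channel_law D \<sigma> n M =
     uniform_count_measure {1..M} \<Otimes>\<^sub>M
       ((\<Pi>\<^sub>M i\<in>{1..n}. D) \<Otimes>\<^sub>M (\<Pi>\<^sub>M i\<in>{1..n}. density lborel (normal_density 0 \<sigma>)))"

definition eh_error_prob ::
    "real measure \<Rightarrow> real \<Rightarrow> nat \<Rightarrow> nat \<Rightarrow> encoder \<Rightarrow> decoder \<Rightarrow> real" where
  "eh_error_prob D \<sigma> n M enc dec =
     measure (eh_channel_law D \<sigma> n M)
       {(m, y, z) \<in> space (eh_channel_law D \<sigma> n M).
          dec (\<lambda>i\<in>{1..n}. channel_input enc m y i + z i) \<noteq> m}"

text \<open>For \<open>\<sigma> > 0\<close> and \<open>0 < \<epsilon> < 1\<close> the set of achievable sizes is non-empty and bounded,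
  so the maximum exists.\<close>

definition eh_max_code_size :: "real measure \<Rightarrow> real \<Rightarrow> nat \<Rightarrow> real \<Rightarrow> nat" where
  "eh_max_code_size D \<sigma> n \<epsilon> =
     (GREATEST M. \<exists>enc dec. eh_code n M enc dec \<and> eh_error_prob D \<sigma> n M enc dec \<le> \<epsilon>)"

definition C_EG :: "real \<Rightarrow> real \<Rightarrow> real" where
  "C_EG P \<sigma> = 1 / 2 * log 2 (1 + P / \<sigma>\<^sup>2)"

definition V_EG :: "real \<Rightarrow> real \<Rightarrow> real" where
  "V_EG P \<sigma> = P / (P + \<sigma>\<^sup>2)"

end

theory Submission
  imports Defs
begin

text \<open>The term of order \<open>sqrt n * (log n) powr a\<close> dominates every term of order \<open>sqrt n\<close>, so it suffices to
  find, for large \<open>n\<close>, codes whose rate loss is half of it and whose error probability is at most \<open>\<epsilon>\<close>;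
  second moments suffice for that, and no central limit theorem is needed. The transmitter is
  silent for about \<open>sqrt n * (log n) powr a / 4\<close> steps and then sends a Gaussian codeword of power
  \<open>EY\<close>, replacing by \<open>0\<close> each symbol the buffer cannot pay for. Kolmogorov's maximal inequality shows
  that the saved energy covers all fluctuations of harvested minus spent energy with probability
  tending to \<open>1\<close>, so the output is that of a plain Gaussian channel except on a small event.
  Feinstein's greedy construction, applied directly to the channel with outages, yields the code.
  Since the maximal code size is defined by \<open>GREATEST\<close>, one also needs a (crude) converse: on an event
  of large probability the inputs lie in a fixed ball, where all output densities are dominated
  by a multiple of one Gaussian density. If \<open>EY = 0\<close>, the bound is trivial.\<close>

text \<open>Scale explains why second moments suffice. The energy reserve and the slack allowed in
  the information density are both of order \<open>sqrt n * \<omega> n\<close> with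
  \<open>\<omega> n\<close> tending to infinity, while the sums they control have standard deviation
  of order \<open>sqrt n\<close>; so these two failure probabilities are of order 1 over
  \<open>\<omega> n\<close> squared. Reserve and slack each cost a quarter of
  \<open>sqrt n * \<omega> n\<close> times the capacity; the spare half absorbs the quantile term, a
  fixed multiple of \<open>sqrt n\<close>, and all constants. The obstacle is that outages tie the
  input to energies the decoder does not see, so the true output law is no product. The decoder
  therefore tests with the likelihood ratio of the outage-free channel, whose two uses separate:
  that few outputs pass the test for a fixed codeword concerns the product reference law alone, and
  that the true output passes it only needs the true and the outage-free output to agree off the
  shortage event. Shortage is estimated jointly over random codeword and energies, so no single
  codeword has to meet a power constraint.\<close>

declare One_nat_def [simp del]

section \<open>Kolmogorov's maximal inequality\<close>

text \<open>The level is tested before the increment is added, so the sum freezes at its first value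
  of modulus at least \<open>L\<close>, overshoot included, and the decision at step
  \<open>Suc k\<close> depends on the first \<open>k\<close> coordinates only.\<close>

fun stopped_sum :: "real \<Rightarrow> (nat \<Rightarrow> 't \<Rightarrow> real) \<Rightarrow> (nat \<Rightarrow> 't) \<Rightarrow> nat \<Rightarrow> real" where
  "stopped_sum L u t 0 = 0"
| "stopped_sum L u t (Suc k) =
     (if L \<le> \<bar>stopped_sum L u t k\<bar> then stopped_sum L u t k
      else stopped_sum L u t k + u (Suc k) (t (Suc k)))"

lemma stopped_sum_measurable:
  assumes "\<And>i. u i \<in> borel_measurable (T i)" and "k \<le> n"
  shows "(\<lambda>t. stopped_sum L u t k) \<in> borel_measurable (Pi\<^sub>M {1..n} T)"
  using assms(2)
proof (induction k)
  case (Suc k)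
  note assms(1)[measurable]
  have [measurable]: "(\<lambda>t. stopped_sum L u t k) \<in> borel_measurable (Pi\<^sub>M {1..n} T)"
    using Suc by simp
  have "Suc k \<in> {1..n}" using Suc.prems by simp
  then have [measurable]: "(\<lambda>t. u (Suc k) (t (Suc k))) \<in> borel_measurable (Pi\<^sub>M {1..n} T)"
    by measurable
  show ?case unfolding stopped_sum.simps by measurable
qed simp

text \<open>Adaptedness: the newest coordinate can be integrated out with the stopped past held
  fixed.\<close>

lemma stopped_sum_upd: "k \<le> n \<Longrightarrow> stopped_sum L u (t(Suc n := y)) k = stopped_sum L u t k"
  by (induction k) auto

lemma stopped_sum_eq:
  "(\<And>j. j < k \<Longrightarrow> \<bar>\<Sum>i\<in>{1..j}. u i (t i)\<bar> < L) \<Longrightarrow> stopped_sum L u t k = (\<Sum>i\<in>{1..k}. u i (t i))"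
proof (induction k)
  case (Suc k)
  have "stopped_sum L u t k = (\<Sum>i\<in>{1..k}. u i (t i))" using Suc by simp
  moreover have "\<bar>\<Sum>i\<in>{1..k}. u i (t i)\<bar> < L" using Suc.prems by blast
  ultimately show ?case by simp
qed simp

lemma stopped_sum_frozen: "L \<le> \<bar>stopped_sum L u t k\<bar> \<Longrightarrow> L \<le> \<bar>stopped_sum L u t (k + d)\<bar>"
  by (induction d) auto

text \<open>Up to the first index where the plain sum reaches \<open>L\<close> both sums agree; from
  there on the stopped one keeps its value.\<close>

lemma stopped_sum_large:
  assumes "k \<le> n" and "L \<le> \<bar>\<Sum>i\<in>{1..k}. u i (t i)\<bar>"
  shows "L \<le> \<bar>stopped_sum L u t n\<bar>"
proof -
  define j where "j = (LEAST k. L \<le> \<bar>\<Sum>i\<in>{1..k}. u i (t i)\<bar>)"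
  have j: "L \<le> \<bar>\<Sum>i\<in>{1..j}. u i (t i)\<bar>" unfolding j_def by (rule LeastI) fact
  have "j \<le> k" unfolding j_def by (rule Least_le) fact
  have "stopped_sum L u t j = (\<Sum>i\<in>{1..j}. u i (t i))"
    by (rule stopped_sum_eq) (use not_less_Least j_def in force)
  with j have "L \<le> \<bar>stopped_sum L u t j\<bar>" by simp
  from stopped_sum_frozen[OF this, of "n - j"] show ?thesis using \<open>j \<le> k\<close> \<open>k \<le> n\<close> by simp
qed

text \<open>The cross term vanishes because \<open>f\<close> is centred. The form with a
  non-negative integral fits the Fubini step of the following induction.\<close>

lemma nn_integral_shifted_square:
  assumes "prob_space M" and [measurable]: "f \<in> borel_measurable M"
    and "integrable M (\<lambda>x. (f x)\<^sup>2)" and "(\<integral>x. f x \<partial>M) = 0"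
  shows "(\<integral>\<^sup>+x. ennreal ((s + f x)\<^sup>2) \<partial>M) = ennreal (s\<^sup>2 + (\<integral>x. (f x)\<^sup>2 \<partial>M))"
proof -
  interpret prob_space M by fact
  have i: "integrable M f" by (rule square_integrable_imp_integrable) fact+
  have e: "(\<lambda>x. (s + f x)\<^sup>2) = (\<lambda>x. s\<^sup>2 + 2 * s * f x + (f x)\<^sup>2)"
    by (auto simp: power2_eq_square algebra_simps)
  have "integrable M (\<lambda>x. (s + f x)\<^sup>2)" unfolding e using i assms(3) by simp
  then have "(\<integral>\<^sup>+x. ennreal ((s + f x)\<^sup>2) \<partial>M) = ennreal (\<integral>x. (s + f x)\<^sup>2 \<partial>M)"
    by (simp add: nn_integral_eq_integral)
  also have "(\<integral>x. (s + f x)\<^sup>2 \<partial>M) = s\<^sup>2 + (\<integral>x. (f x)\<^sup>2 \<partial>M)"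
    unfolding e using i assms(3,4) by (simp add: prob_space)
  finally show ?thesis .
qed

lemma nn_integral_stopped_sum:
  fixes T :: "nat \<Rightarrow> 't measure" and u :: "nat \<Rightarrow> 't \<Rightarrow> real"
  assumes prob: "\<And>i. prob_space (T i)"
    and meas [measurable]: "\<And>i. u i \<in> borel_measurable (T i)"
    and sq: "\<And>i. integrable (T i) (\<lambda>x. (u i x)\<^sup>2)"
    and mean: "\<And>i. (\<integral>x. u i x \<partial>T i) = 0"
  shows "(\<integral>\<^sup>+t. ennreal ((stopped_sum L u t n)\<^sup>2) \<partial>Pi\<^sub>M {1..n} T)
    \<le> ennreal (\<Sum>i\<in>{1..n}. \<integral>x. (u i x)\<^sup>2 \<partial>T i)"
proof (induction n)
  case (Suc n)
  interpret product_sigma_finite T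
    by (simp add: product_sigma_finite_def prob prob_space_imp_sigma_finite)
  have [measurable]: "(\<lambda>t. stopped_sum L u t (Suc n)) \<in> borel_measurable (Pi\<^sub>M {1..Suc n} T)"
    "(\<lambda>t. stopped_sum L u t n) \<in> borel_measurable (Pi\<^sub>M {1..n} T)"
    using stopped_sum_measurable[of u T, OF meas] by blast+
  let ?v = "\<integral>x. (u (Suc n) x)\<^sup>2 \<partial>T (Suc n)"
  have ins: "{1..Suc n} = insert (Suc n) {1..n}" by auto
  have *: "(\<integral>\<^sup>+y. ennreal ((stopped_sum L u (t(Suc n := y)) (Suc n))\<^sup>2) \<partial>T (Suc n))
      \<le> ennreal ((stopped_sum L u t n)\<^sup>2) + ennreal ?v" for t
  proof (cases "L \<le> \<bar>stopped_sum L u t n\<bar>")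
    case True
    interpret prob_space "T (Suc n)" by (rule prob)
    show ?thesis using True by (simp add: stopped_sum_upd emeasure_space_1)
  next
    case False
    then show ?thesis
      by (simp add: stopped_sum_upd nn_integral_shifted_square[OF prob meas sq mean] ennreal_plus)
  qed
  have "(\<integral>\<^sup>+t. ennreal ((stopped_sum L u t (Suc n))\<^sup>2) \<partial>Pi\<^sub>M {1..Suc n} T)
      = (\<integral>\<^sup>+t. \<integral>\<^sup>+y. ennreal ((stopped_sum L u (t(Suc n := y)) (Suc n))\<^sup>2) \<partial>T (Suc n) \<partial>Pi\<^sub>M {1..n} T)"
    unfolding ins
  proof (rule product_nn_integral_insert)
    show "(\<lambda>t. ennreal ((stopped_sum L u t (Suc n))\<^sup>2)) \<in> borel_measurable (Pi\<^sub>M (insert (Suc n) {1..n}) T)"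
      unfolding ins[symmetric] by measurable
  qed auto
  also have "\<dots> \<le> (\<integral>\<^sup>+t. ennreal ((stopped_sum L u t n)\<^sup>2) + ennreal ?v \<partial>Pi\<^sub>M {1..n} T)"
    by (intro nn_integral_mono *)
  also have "\<dots> = (\<integral>\<^sup>+t. ennreal ((stopped_sum L u t n)\<^sup>2) \<partial>Pi\<^sub>M {1..n} T) + ennreal ?v"
    by (subst nn_integral_add)
      (auto simp: prob_space.emeasure_space_1[OF prob_space_PiM[OF prob]])
  also have "\<dots> \<le> ennreal (\<Sum>i\<in>{1..n}. \<integral>x. (u i x)\<^sup>2 \<partial>T i) + ennreal ?v"
    by (intro add_mono Suc order_refl)
  also have "\<dots> = ennreal (\<Sum>i\<in>{1..Suc n}. \<integral>x. (u i x)\<^sup>2 \<partial>T i)"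
    by (subst ennreal_plus[symmetric]) (auto intro!: sum_nonneg)
  finally show ?case .
qed simp

text \<open>The sum is stopped when it first reaches \<open>L\<close>; Chebyshev's inequality for the stopped sum
  then controls the whole path.\<close>

lemma kolmogorov_maximal_inequality:
  fixes T :: "nat \<Rightarrow> 't measure" and u :: "nat \<Rightarrow> 't \<Rightarrow> real"
  assumes prob: "\<And>i. prob_space (T i)"
    and meas [measurable]: "\<And>i. u i \<in> borel_measurable (T i)"
    and sq: "\<And>i. integrable (T i) (\<lambda>x. (u i x)\<^sup>2)"
    and mean: "\<And>i. (\<integral>x. u i x \<partial>T i) = 0"
    and "0 < L"
  shows "measure (Pi\<^sub>M {1..n} T)
      {t \<in> space (Pi\<^sub>M {1..n} T). \<exists>k\<le>n. L \<le> \<bar>\<Sum>i\<in>{1..k}. u i (t i)\<bar>}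
    \<le> (\<Sum>i\<in>{1..n}. \<integral>x. (u i x)\<^sup>2 \<partial>T i) / L\<^sup>2"
proof -
  let ?P = "Pi\<^sub>M {1..n} T" and ?V = "\<Sum>i\<in>{1..n}. \<integral>x. (u i x)\<^sup>2 \<partial>T i"
  interpret P: prob_space ?P by (rule prob_space_PiM[OF prob])
  have V: "0 \<le> ?V" by (auto intro!: sum_nonneg)
  have [measurable]: "(\<lambda>t. stopped_sum L u t n) \<in> borel_measurable ?P"
    using stopped_sum_measurable[of u T, OF meas] by blast
  have "measure ?P {t \<in> space ?P. \<exists>k\<le>n. L \<le> \<bar>\<Sum>i\<in>{1..k}. u i (t i)\<bar>}
      \<le> measure ?P {t \<in> space ?P. 1 \<le> ennreal (1 / L\<^sup>2) * ennreal ((stopped_sum L u t n)\<^sup>2)}"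
  proof (rule P.finite_measure_mono)
    show "{t \<in> space ?P. \<exists>k\<le>n. L \<le> \<bar>\<Sum>i\<in>{1..k}. u i (t i)\<bar>}
      \<subseteq> {t \<in> space ?P. 1 \<le> ennreal (1 / L\<^sup>2) * ennreal ((stopped_sum L u t n)\<^sup>2)}"
    proof (clarsimp)
      fix t k assume "k \<le> n" "L \<le> \<bar>\<Sum>i\<in>{1..k}. u i (t i)\<bar>"
      with stopped_sum_large[of k n L u t] have "L \<le> \<bar>stopped_sum L u t n\<bar>" by simp
      then have "L\<^sup>2 \<le> (stopped_sum L u t n)\<^sup>2"
        using \<open>0 < L\<close> by (metis abs_le_square_iff abs_of_pos)
      then have "1 \<le> 1 / L\<^sup>2 * (stopped_sum L u t n)\<^sup>2" using \<open>0 < L\<close> by (simp add: field_simps)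
      then show "1 \<le> ennreal (1 / L\<^sup>2) * ennreal ((stopped_sum L u t n)\<^sup>2)"
        by (simp add: ennreal_mult[symmetric])
    qed
  qed measurable
  also have "\<dots> \<le> ?V / L\<^sup>2"
  proof -
    have "emeasure ?P {t \<in> space ?P. 1 \<le> ennreal (1 / L\<^sup>2) * ennreal ((stopped_sum L u t n)\<^sup>2)}
        \<le> ennreal (1 / L\<^sup>2) * (\<integral>\<^sup>+t. ennreal ((stopped_sum L u t n)\<^sup>2) \<partial>?P)"
      using nn_integral_Markov_inequality[where M = ?P and A = "space ?P"
          and u = "\<lambda>t. ennreal ((stopped_sum L u t n)\<^sup>2)" and c = "ennreal (1 / L\<^sup>2)"]
      by (simp add: nn_integral_set_ennreal[symmetric] cong: nn_integral_cong)
    also have "\<dots> \<le> ennreal (1 / L\<^sup>2) * ennreal ?V"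
      by (intro mult_left_mono nn_integral_stopped_sum assms) auto
    also have "\<dots> = ennreal (?V / L\<^sup>2)" by (subst ennreal_mult[symmetric]) (use V in auto)
    finally show ?thesis using V by (simp add: P.emeasure_eq_measure)
  qed
  finally show ?thesis .
qed

section \<open>Product measures\<close>

lemma indicator_PiE_restrict:
  assumes "finite I"
  shows "indicator (Pi\<^sub>E I E) (\<lambda>i\<in>I. g i) = (\<Prod>i\<in>I. indicator (E i) (g i) :: ennreal)"
proof (cases "\<forall>i\<in>I. g i \<in> E i")
  case True
  then show ?thesis by auto
next
  case False
  then obtain i where "i \<in> I" "g i \<notin> E i" by blast
  then have "(\<Prod>i\<in>I. indicator (E i) (g i) :: ennreal) = 0"
    using assms by (intro prod_zero) (auto intro!: bexI[of _ i])
  moreover have "(\<lambda>i\<in>I. g i) \<notin> Pi\<^sub>E I E"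
    using \<open>i \<in> I\<close> \<open>g i \<notin> E i\<close> by (auto simp: PiE_iff)
  ultimately show ?thesis by simp
qed

text \<open>The coding argument lives on three separate sequences (codeword, energies, noise), the
  maximal inequality on one sequence of independent letters; this identity moves events between the
  two spaces. Both laws agree on boxes, by Fubini and by pulling the product out of one integral
  after another, innermost first.\<close>

lemma triple_PiM:
  assumes A: "\<And>i. prob_space (A i)" and B: "\<And>i. prob_space (B i)" and C: "\<And>i. prob_space (C i)"
    and I: "finite I"
  shows "distr (Pi\<^sub>M I A \<Otimes>\<^sub>M (Pi\<^sub>M I B \<Otimes>\<^sub>M Pi\<^sub>M I C)) (\<Pi>\<^sub>M i\<in>I. A i \<Otimes>\<^sub>M (B i \<Otimes>\<^sub>M C i))
      (\<lambda>(x, y, z). \<lambda>i\<in>I. (x i, y i, z i)) = (\<Pi>\<^sub>M i\<in>I. A i \<Otimes>\<^sub>M (B i \<Otimes>\<^sub>M C i))"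
proof -
  let ?P = "Pi\<^sub>M I A \<Otimes>\<^sub>M (Pi\<^sub>M I B \<Otimes>\<^sub>M Pi\<^sub>M I C)" and ?T = "\<lambda>i. A i \<Otimes>\<^sub>M (B i \<Otimes>\<^sub>M C i)"
  let ?z = "\<lambda>(x, y, z). \<lambda>i\<in>I. (x i, y i, z i)"
  interpret A: product_sigma_finite A
    by (simp add: product_sigma_finite_def A prob_space_imp_sigma_finite)
  interpret B: product_sigma_finite B
    by (simp add: product_sigma_finite_def B prob_space_imp_sigma_finite)
  interpret C: product_sigma_finite C
    by (simp add: product_sigma_finite_def C prob_space_imp_sigma_finite)
  have T: "prob_space (?T i)" for i
    by (intro prob_space_pair A B C)
  interpret T: product_sigma_finite ?T
    unfolding product_sigma_finite_def using T prob_space_imp_sigma_finite by blast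
  interpret PB: prob_space "Pi\<^sub>M I B" by (rule prob_space_PiM[OF B])
  interpret PC: prob_space "Pi\<^sub>M I C" by (rule prob_space_PiM[OF C])
  interpret PBC: prob_space "Pi\<^sub>M I B \<Otimes>\<^sub>M Pi\<^sub>M I C"
    by (intro prob_space_pair PB.prob_space_axioms PC.prob_space_axioms)
  have z [measurable]: "?z \<in> measurable ?P (Pi\<^sub>M I ?T)"
    by (intro measurable_split_conv[THEN iffD2] measurable_restrict) measurable
  show ?thesis
  proof (rule T.PiM_eqI[OF I])
    fix E assume E [measurable]: "\<And>i. i \<in> I \<Longrightarrow> E i \<in> sets (?T i)"
    have [measurable]: "Pi\<^sub>E I E \<in> sets (Pi\<^sub>M I ?T)"
      by (intro sets_PiM_I_finite I E)
    have "emeasure (distr ?P (Pi\<^sub>M I ?T) ?z) (Pi\<^sub>E I E)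
        = (\<integral>\<^sup>+p. indicator (Pi\<^sub>E I E) (?z p) \<partial>?P)"
      by (simp add: nn_integral_distr flip: nn_integral_indicator)
    also have "\<dots> = (\<integral>\<^sup>+p. (\<Prod>i\<in>I. indicator (E i) (fst p i, fst (snd p) i, snd (snd p) i)) \<partial>?P)"
      by (intro nn_integral_cong) (simp add: split_beta indicator_PiE_restrict I)
    also have "\<dots> = (\<integral>\<^sup>+x. \<integral>\<^sup>+y. \<integral>\<^sup>+z. (\<Prod>i\<in>I. indicator (E i) (x i, y i, z i))
        \<partial>Pi\<^sub>M I C \<partial>Pi\<^sub>M I B \<partial>Pi\<^sub>M I A)"
    proof (subst PBC.nn_integral_fst[symmetric], measurable, intro nn_integral_cong)
      fix x assume "x \<in> space (Pi\<^sub>M I A)"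
      then have [simp]: "x i \<in> space (A i)" if "i \<in> I" for i
        using that by (auto simp: space_PiM)
      show "(\<integral>\<^sup>+q. (\<Prod>i\<in>I. indicator (E i) (fst (x, q) i, fst (snd (x, q)) i, snd (snd (x, q)) i))
          \<partial>(Pi\<^sub>M I B \<Otimes>\<^sub>M Pi\<^sub>M I C))
        = (\<integral>\<^sup>+y. \<integral>\<^sup>+z. (\<Prod>i\<in>I. indicator (E i) (x i, y i, z i)) \<partial>Pi\<^sub>M I C \<partial>Pi\<^sub>M I B)"
        unfolding fst_conv snd_conv by (subst PC.nn_integral_fst[symmetric]) simp_all
    qed
    also have "\<dots> = (\<integral>\<^sup>+x. \<integral>\<^sup>+y. (\<Prod>i\<in>I. \<integral>\<^sup>+z. indicator (E i) (x i, y i, z) \<partial>C i)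
        \<partial>Pi\<^sub>M I B \<partial>Pi\<^sub>M I A)"
    proof (intro nn_integral_cong)
      fix x y assume "x \<in> space (Pi\<^sub>M I A)" "y \<in> space (Pi\<^sub>M I B)"
      then have [simp]: "x i \<in> space (A i)" "y i \<in> space (B i)" if "i \<in> I" for i
        using that by (auto simp: space_PiM)
      show "(\<integral>\<^sup>+z. (\<Prod>i\<in>I. indicator (E i) (x i, y i, z i)) \<partial>Pi\<^sub>M I C)
          = (\<Prod>i\<in>I. \<integral>\<^sup>+z. indicator (E i) (x i, y i, z) \<partial>C i)"
        by (rule C.product_nn_integral_prod[OF I]) measurable
    qed
    also have "\<dots> = (\<integral>\<^sup>+x. (\<Prod>i\<in>I. \<integral>\<^sup>+y. \<integral>\<^sup>+z. indicator (E i) (x i, y, z) \<partial>C i \<partial>B i) \<partial>Pi\<^sub>M I A)"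
    proof (intro nn_integral_cong)
      fix x assume "x \<in> space (Pi\<^sub>M I A)"
      then have [simp]: "x i \<in> space (A i)" if "i \<in> I" for i
        using that by (auto simp: space_PiM)
      show "(\<integral>\<^sup>+y. (\<Prod>i\<in>I. \<integral>\<^sup>+z. indicator (E i) (x i, y i, z) \<partial>C i) \<partial>Pi\<^sub>M I B)
          = (\<Prod>i\<in>I. \<integral>\<^sup>+y. \<integral>\<^sup>+z. indicator (E i) (x i, y, z) \<partial>C i \<partial>B i)"
        by (rule B.product_nn_integral_prod[OF I]) measurable
    qed
    also have "\<dots> = (\<Prod>i\<in>I. \<integral>\<^sup>+x. \<integral>\<^sup>+y. \<integral>\<^sup>+z. indicator (E i) (x, y, z) \<partial>C i \<partial>B i \<partial>A i)"
      by (rule A.product_nn_integral_prod[OF I]) measurable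
    also have "\<dots> = (\<Prod>i\<in>I. emeasure (?T i) (E i))"
    proof (intro prod.cong refl)
      fix i assume "i \<in> I"
      interpret BCi: prob_space "B i \<Otimes>\<^sub>M C i" by (intro prob_space_pair B C)
      have [measurable]: "E i \<in> sets (?T i)" using E \<open>i \<in> I\<close> by blast
      have "emeasure (?T i) (E i) = (\<integral>\<^sup>+p. indicator (E i) p \<partial>?T i)" by simp
      also have "\<dots> = (\<integral>\<^sup>+x. \<integral>\<^sup>+y. \<integral>\<^sup>+z. indicator (E i) (x, y, z) \<partial>C i \<partial>B i \<partial>A i)"
        by (subst BCi.nn_integral_fst[symmetric], measurable)
          (intro nn_integral_cong,
            subst sigma_finite_measure.nn_integral_fst[OF prob_space_imp_sigma_finite[OF C], symmetric],
            measurable)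
      finally show "(\<integral>\<^sup>+x. \<integral>\<^sup>+y. \<integral>\<^sup>+z. indicator (E i) (x, y, z) \<partial>C i \<partial>B i \<partial>A i)
          = emeasure (?T i) (E i)" by simp
    qed
    finally show "emeasure (distr ?P (Pi\<^sub>M I ?T) ?z) (Pi\<^sub>E I E) = (\<Prod>i\<in>I. emeasure (?T i) (E i))" .
  qed simp
qed

text \<open>Coordinatewise images of independent variables are independent. It serves twice: for the
  noise shifted by fixed inputs in the converse and for the law of the outage-free output.\<close>

lemma distr_PiM_componentwise:
  assumes M: "\<And>i. prob_space (M i)" and f [measurable]: "\<And>i. f i \<in> measurable (M i) (N i)"
    and I: "finite I"
  shows "distr (Pi\<^sub>M I M) (Pi\<^sub>M I N) (\<lambda>t. \<lambda>i\<in>I. f i (t i)) = Pi\<^sub>M I (\<lambda>i. distr (M i) (N i) (f i))"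
proof -
  interpret M: product_prob_space M
    using M by (simp add: product_prob_space_def product_prob_space_axioms_def product_sigma_finite_def
        prob_space_imp_sigma_finite)
  have N: "prob_space (distr (M i) (N i) (f i))" for i
    by (rule prob_space.prob_space_distr[OF M f])
  interpret N: product_sigma_finite "\<lambda>i. distr (M i) (N i) (f i)"
    by (simp add: product_sigma_finite_def N prob_space_imp_sigma_finite)
  have F [measurable]: "(\<lambda>t. \<lambda>i\<in>I. f i (t i)) \<in> measurable (Pi\<^sub>M I M) (Pi\<^sub>M I N)" by measurable
  show ?thesis
  proof (rule N.PiM_eqI[OF I])
    show "sets (distr (Pi\<^sub>M I M) (Pi\<^sub>M I N) (\<lambda>t. \<lambda>i\<in>I. f i (t i)))
        = sets (Pi\<^sub>M I (\<lambda>i. distr (M i) (N i) (f i)))"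
      by (simp cong: sets_PiM_cong)
  next
    fix E assume "\<And>i. i \<in> I \<Longrightarrow> E i \<in> sets (distr (M i) (N i) (f i))"
    then have E [measurable]: "\<And>i. i \<in> I \<Longrightarrow> E i \<in> sets (N i)" by simp
    have PE: "Pi\<^sub>E I E \<in> sets (Pi\<^sub>M I N)" by (intro sets_PiM_I_finite I E)
    have "(\<lambda>t. \<lambda>i\<in>I. f i (t i)) -` Pi\<^sub>E I E \<inter> space (Pi\<^sub>M I M)
        = Pi\<^sub>E I (\<lambda>i. f i -` E i \<inter> space (M i))"
      by (auto simp: space_PiM PiE_iff)
    then have "emeasure (distr (Pi\<^sub>M I M) (Pi\<^sub>M I N) (\<lambda>t. \<lambda>i\<in>I. f i (t i))) (Pi\<^sub>E I E)
        = emeasure (Pi\<^sub>M I M) (Pi\<^sub>E I (\<lambda>i. f i -` E i \<inter> space (M i)))"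
      using PE by (simp add: emeasure_distr)
    also have "\<dots> = (\<Prod>i\<in>I. emeasure (M i) (f i -` E i \<inter> space (M i)))"
      by (rule M.emeasure_PiM[OF I]) measurable
    also have "\<dots> = (\<Prod>i\<in>I. emeasure (distr (M i) (N i) (f i)) (E i))"
      by (intro prod.cong) (simp_all add: emeasure_distr)
    finally show "emeasure (distr (Pi\<^sub>M I M) (Pi\<^sub>M I N) (\<lambda>t. \<lambda>i\<in>I. f i (t i))) (Pi\<^sub>E I E)
        = (\<Prod>i\<in>I. emeasure (distr (M i) (N i) (f i)) (E i))" .
  qed
qed

section \<open>Gaussian laws\<close>

lemma integrable_square_diff:
  fixes f g :: "'a \<Rightarrow> real"
  assumes [measurable]: "f \<in> borel_measurable M" "g \<in> borel_measurable M"
    and "integrable M (\<lambda>x. (f x)\<^sup>2)" "integrable M (\<lambda>x. (g x)\<^sup>2)"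
  shows "integrable M (\<lambda>x. (f x - g x)\<^sup>2)"
proof (rule Bochner_Integration.integrable_bound)
  show "integrable M (\<lambda>x. 2 * (f x)\<^sup>2 + 2 * (g x)\<^sup>2)" using assms by simp
  show "AE x in M. norm ((f x - g x)\<^sup>2) \<le> norm (2 * (f x)\<^sup>2 + 2 * (g x)\<^sup>2)"
  proof (rule AE_I2)
    fix x
    have "0 \<le> (f x + g x)\<^sup>2" by simp
    then have "(f x - g x)\<^sup>2 \<le> 2 * (f x)\<^sup>2 + 2 * (g x)\<^sup>2"
      by (simp add: power2_eq_square algebra_simps)
    then show "norm ((f x - g x)\<^sup>2) \<le> norm (2 * (f x)\<^sup>2 + 2 * (g x)\<^sup>2)"
      by (simp add: abs_of_nonneg)
  qed
qed measurable

abbreviation gauss :: "real \<Rightarrow> real measure" where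
  "gauss s \<equiv> density lborel (\<lambda>x. ennreal (normal_density 0 s x))"

lemma prob_space_gauss: "0 < s \<Longrightarrow> prob_space (gauss s)"
  by (rule prob_space_normal_density)

lemma integrable_gauss_power: "0 < s \<Longrightarrow> integrable (gauss s) (\<lambda>x. x ^ k)"
  using integrable_normal_moment[of s 0 k] by (simp add: integrable_density normal_density_nonneg)

lemma integral_gauss_square: "0 < s \<Longrightarrow> (\<integral>x. x\<^sup>2 \<partial>gauss s) = s\<^sup>2"
  using integral_normal_moment_even[of s 0 1]
  by (simp add: integral_density normal_density_nonneg field_simps fact_numeral)

lemma distr_gauss_add:
  assumes [arith]: "0 < s" "0 < t"
  shows "distr (gauss s \<Otimes>\<^sub>M gauss t) borel (\<lambda>(x, z). x + z) = gauss (sqrt (s\<^sup>2 + t\<^sup>2))"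
proof -
  interpret s: prob_space "gauss s" by (rule prob_space_gauss) simp
  interpret t: prob_space "gauss t" by (rule prob_space_gauss) simp
  have "distr (gauss s \<Otimes>\<^sub>M gauss t) borel (\<lambda>(x, z). x + z)
      = density lborel (\<lambda>x. \<integral>\<^sup>+y. ennreal (normal_density 0 s (x - y)) * ennreal (normal_density 0 t y) \<partial>lborel)"
    unfolding convolution_def[symmetric]
    by (rule convolution_density) (auto simp: s.finite_measure_axioms t.finite_measure_axioms)
  also have "\<dots> = gauss (sqrt (s\<^sup>2 + t\<^sup>2))"
    using conv_normal_density_zero_mean[of s t]
    by (simp add: ennreal_mult'[symmetric] normal_density_nonneg)
  finally show ?thesis .
qed

text \<open>Markov's inequality for the likelihood ratio of the normal law centred at \<open>x i\<close> with respect
  to the output law.\<close>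

lemma measure_information_density_le:
  assumes I: "finite I" and J: "J \<subseteq> I" and [arith]: "0 < \<sigma>" "0 < \<tau>"
  shows "measure (\<Pi>\<^sub>M i\<in>I. gauss (if i \<in> J then \<tau> else \<sigma>)) {w \<in> space (\<Pi>\<^sub>M i\<in>I. gauss (if i \<in> J then \<tau> else \<sigma>)).
      \<gamma> < (\<Sum>i\<in>J. ln (\<tau> / \<sigma>) + (w i)\<^sup>2 / (2 * \<tau>\<^sup>2) - (w i - x i)\<^sup>2 / (2 * \<sigma>\<^sup>2))} \<le> exp (- \<gamma>)"
proof -
  let ?G = "\<lambda>i. gauss (if i \<in> J then \<tau> else \<sigma>)"
  let ?P = "Pi\<^sub>M I ?G"
  let ?d = "\<lambda>i w. ln (\<tau> / \<sigma>) + w\<^sup>2 / (2 * \<tau>\<^sup>2) - (w - x i)\<^sup>2 / (2 * \<sigma>\<^sup>2)"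
  have G: "prob_space (?G i)" for i by (simp add: prob_space_gauss)
  interpret P: prob_space ?P by (rule prob_space_PiM[OF G])
  interpret G: product_sigma_finite ?G
    unfolding product_sigma_finite_def using G prob_space_imp_sigma_finite by blast
  have [measurable]: "i \<in> J \<Longrightarrow> (\<lambda>w. w i) \<in> borel_measurable ?P" for i
    using J by (subst measurable_cong_sets[OF refl, of borel "?G i"]) auto
  have one: "(\<integral>\<^sup>+w. (if i \<in> J then ennreal (exp (?d i w)) else 1) \<partial>?G i) = 1" for i
  proof (cases "i \<in> J")
    case True
    \<comment> \<open>The exponential of \<open>?d i\<close> is the ratio of two normal densities,
      and \<open>ln (\<tau> / \<sigma>)\<close> accounts for their normalising constants; hence each
      factor integrates to 1.\<close>
    have "normal_density 0 \<tau> w * exp (?d i w) = normal_density (x i) \<sigma> w" for w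
    proof -
      have "exp (?d i w) = exp (ln (\<tau> / \<sigma>) + (w\<^sup>2 / (2 * \<tau>\<^sup>2) + - (w - x i)\<^sup>2 / (2 * \<sigma>\<^sup>2)))"
        by (simp add: algebra_simps)
      also have "\<dots> = \<tau> / \<sigma> * (exp (w\<^sup>2 / (2 * \<tau>\<^sup>2)) * exp (- (w - x i)\<^sup>2 / (2 * \<sigma>\<^sup>2)))"
        unfolding exp_add by simp
      finally have "normal_density 0 \<tau> w * exp (?d i w)
          = (exp (- w\<^sup>2 / (2 * \<tau>\<^sup>2)) * exp (w\<^sup>2 / (2 * \<tau>\<^sup>2)))
            * (\<tau> / sqrt (2 * pi * \<tau>\<^sup>2) / \<sigma> * exp (- (w - x i)\<^sup>2 / (2 * \<sigma>\<^sup>2)))"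
        by (simp add: normal_density_def)
      also have "exp (- w\<^sup>2 / (2 * \<tau>\<^sup>2)) * exp (w\<^sup>2 / (2 * \<tau>\<^sup>2)) = 1"
        unfolding exp_add[symmetric] by simp
      finally show ?thesis
        by (simp add: normal_density_def real_sqrt_mult)
    qed
    then have "(\<integral>\<^sup>+w. ennreal (exp (?d i w)) \<partial>gauss \<tau>) = (\<integral>\<^sup>+w. ennreal (normal_density (x i) \<sigma> w) \<partial>lborel)"
      by (subst nn_integral_density) (auto simp: ennreal_mult'[symmetric] normal_density_nonneg)
    also have "\<dots> = 1"
      by (subst nn_integral_eq_integral) (auto simp: normal_density_nonneg)
    finally show ?thesis using True by simp
  next
    case False
    interpret prob_space "gauss \<sigma>" by (rule prob_space_gauss) simp
    show ?thesis using False emeasure_space_1 by simp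
  qed
  \<comment> \<open>Coordinates outside \<open>J\<close> get the factor 1, so that the product runs
    over all of \<open>I\<close> and Fubini for the full product measure applies.\<close>
  have expS: "ennreal (exp (\<Sum>i\<in>J. ?d i (w i))) = (\<Prod>i\<in>I. if i \<in> J then ennreal (exp (?d i (w i))) else 1)" for w
  proof -
    have "finite J" using I J finite_subset by blast
    then have "ennreal (exp (\<Sum>i\<in>J. ?d i (w i))) = (\<Prod>i\<in>J. ennreal (exp (?d i (w i))))"
      by (simp add: exp_sum prod_ennreal)
    also have "\<dots> = (\<Prod>i\<in>I. if i \<in> J then ennreal (exp (?d i (w i))) else 1)"
      by (intro prod.mono_neutral_cong_left I J) auto
    finally show ?thesis .
  qed
  let ?B = "{w \<in> space ?P. 1 \<le> ennreal (exp (- \<gamma>)) * ennreal (exp (\<Sum>i\<in>J. ?d i (w i)))}"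
  have "measure ?P {w \<in> space ?P. \<gamma> < (\<Sum>i\<in>J. ?d i (w i))} \<le> measure ?P ?B"
  proof (rule P.finite_measure_mono)
    show "{w \<in> space ?P. \<gamma> < (\<Sum>i\<in>J. ?d i (w i))} \<subseteq> ?B"
      by (auto simp: ennreal_mult'[symmetric] exp_add[symmetric])
  qed measurable
  also have "\<dots> \<le> exp (- \<gamma>)"
  proof -
    have "emeasure ?P ?B \<le> ennreal (exp (- \<gamma>)) * (\<integral>\<^sup>+w. ennreal (exp (\<Sum>i\<in>J. ?d i (w i))) * indicator (space ?P) w \<partial>?P)"
      by (rule nn_integral_Markov_inequality) measurable
    also have "(\<integral>\<^sup>+w. ennreal (exp (\<Sum>i\<in>J. ?d i (w i))) * indicator (space ?P) w \<partial>?P)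
        = (\<integral>\<^sup>+w. ennreal (exp (\<Sum>i\<in>J. ?d i (w i))) \<partial>?P)"
      by (intro nn_integral_cong) simp
    also have "\<dots> = (\<Prod>i\<in>I. \<integral>\<^sup>+w. (if i \<in> J then ennreal (exp (?d i w)) else 1) \<partial>?G i)"
      unfolding expS by (rule G.product_nn_integral_prod[OF I]) simp
    also have "\<dots> = 1" by (simp only: one prod.neutral_const)
    finally show ?thesis by (simp add: P.emeasure_eq_measure)
  qed
  finally show ?thesis .
qed

section \<open>Feinstein's greedy construction\<close>

text \<open>Codewords are added one at a time. If no codeword could be added to a code of size \<open>M\<close>, then
  averaging over the input law would contradict \<open>good\<close>, since the decoded region has output
  probability at most \<open>M * g\<close>. The decoder value \<open>0\<close> stands for an output that is not decoded.\<close>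

lemma feinstein:
  fixes PX :: "'x measure" and T :: "'t measure" and PW :: "'w measure"
  assumes PX: "prob_space PX" and T: "prob_space T" and PW: "prob_space PW"
    and h [measurable]: "(\<lambda>(x, t). h x t) \<in> measurable (PX \<Otimes>\<^sub>M T) PW"
    and D [measurable]: "Measurable.pred (PX \<Otimes>\<^sub>M PW) (\<lambda>(x, w). D x w)"
    and g: "\<And>x. x \<in> space PX \<Longrightarrow> measure PW {w \<in> space PW. D x w} \<le> g" and "0 \<le> g"
    and good: "\<And>U. U \<in> sets PW \<Longrightarrow> 1 - \<delta> - measure PW U
        \<le> measure (PX \<Otimes>\<^sub>M T) {(x, t) \<in> space (PX \<Otimes>\<^sub>M T). D x (h x t) \<and> h x t \<notin> U}"
    and M: "\<delta> + (real M - 1) * g < \<epsilon>"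
  shows "\<exists>c dec. (\<forall>m\<in>{1..M}. c m \<in> space PX) \<and> dec \<in> measurable PW (count_space UNIV) \<and>
      (\<forall>w\<in>space PW. dec w \<le> M) \<and> measure PW {w \<in> space PW. dec w \<noteq> 0} \<le> real M * g \<and>
      (\<forall>m\<in>{1..M}. 1 - \<epsilon> \<le> measure T {t \<in> space T. dec (h (c m) t) = m})"
  using M
proof (induction M)
  case 0
  show ?case by (intro exI[of _ "\<lambda>_. undefined"] exI[of _ "\<lambda>_. 0"]) simp
next
  case (Suc M)
  interpret X: prob_space PX by (rule PX)
  interpret T: prob_space T by (rule T)
  interpret W: prob_space PW by (rule PW)
  interpret XT: prob_space "PX \<Otimes>\<^sub>M T" by (intro prob_space_pair PX T)
  \<comment> \<open>The hypothesis counts one codeword less than the code has, because the last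
    codeword only has to avoid the regions of its predecessors. For size \<open>Suc M\<close> it is
    exactly what the \<open>M\<close> existing regions cost.\<close>
  have M: "\<delta> + real M * g < \<epsilon>" using Suc.prems by simp
  have "\<delta> + (real M - 1) * g < \<epsilon>" using M \<open>0 \<le> g\<close> by (simp add: left_diff_distrib)
  from Suc.IH[OF this] obtain c dec where c: "\<And>m. m \<in> {1..M} \<Longrightarrow> c m \<in> space PX"
    and dec [measurable]: "dec \<in> measurable PW (count_space UNIV)"
    and dec_le: "\<And>w. w \<in> space PW \<Longrightarrow> dec w \<le> M"
    and dec_g: "measure PW {w \<in> space PW. dec w \<noteq> 0} \<le> real M * g"
    and err: "\<And>m. m \<in> {1..M} \<Longrightarrow> 1 - \<epsilon> \<le> measure T {t \<in> space T. dec (h (c m) t) = m}"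
    by blast
  define U where "U = {w \<in> space PW. dec w \<noteq> 0}"
  have U [measurable]: "U \<in> sets PW" unfolding U_def by measurable
  \<comment> \<open>The section of \<open>E\<close> at \<open>x\<close> is the set of channel states
    for which \<open>x\<close>, taken as the next codeword, would be decoded correctly.\<close>
  define E where "E = {(x, t) \<in> space (PX \<Otimes>\<^sub>M T). D x (h x t) \<and> h x t \<notin> U}"
  have [measurable]: "(\<lambda>p. h (fst p) (snd p)) \<in> measurable (PX \<Otimes>\<^sub>M T) PW"
    using h by (simp add: split_beta')
  have "(\<lambda>p. (fst p, h (fst p) (snd p))) \<in> measurable (PX \<Otimes>\<^sub>M T) (PX \<Otimes>\<^sub>M PW)" by measurable
  from measurable_compose[OF this D]
  have [measurable]: "Measurable.pred (PX \<Otimes>\<^sub>M T) (\<lambda>p. D (fst p) (h (fst p) (snd p)))" by simp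
  have "E = {p \<in> space (PX \<Otimes>\<^sub>M T). D (fst p) (h (fst p) (snd p)) \<and> h (fst p) (snd p) \<notin> U}"
    by (auto simp: E_def)
  then have E [measurable]: "E \<in> sets (PX \<Otimes>\<^sub>M T)" by simp
  have hs: "h x t \<in> space PW" if "x \<in> space PX" "t \<in> space T" for x t
    using measurable_space[OF h, of "(x, t)"] that by (simp add: space_pair_measure)
  have "\<exists>x\<in>space PX. 1 - \<epsilon> \<le> measure T (Pair x -` E)"
  proof (rule ccontr)
    assume "\<not> ?thesis"
    then have less: "measure T (Pair x -` E) \<le> 1 - \<epsilon>" if "x \<in> space PX" for x
      using that by force
    obtain x0 where "x0 \<in> space PX" using X.not_empty by blast
    \<comment> \<open>Needed to return from \<open>ennreal\<close> to the reals, since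
      \<open>ennreal\<close> sends negative numbers to 0.\<close>
    then have "0 \<le> 1 - \<epsilon>" using less measure_nonneg order_trans by blast
    have "emeasure (PX \<Otimes>\<^sub>M T) E = (\<integral>\<^sup>+x. emeasure T (Pair x -` E) \<partial>PX)"
      by (rule T.emeasure_pair_measure_alt) measurable
    also have "\<dots> \<le> (\<integral>\<^sup>+x. ennreal (1 - \<epsilon>) \<partial>PX)"
      by (intro nn_integral_mono) (simp add: T.emeasure_eq_measure less ennreal_leI)
    also have "\<dots> = ennreal (1 - \<epsilon>)" by (simp add: X.emeasure_space_1)
    finally have "measure (PX \<Otimes>\<^sub>M T) E \<le> 1 - \<epsilon>"
      using \<open>0 \<le> 1 - \<epsilon>\<close> by (simp add: XT.emeasure_eq_measure)
    then show False using good[OF U] dec_g M unfolding E_def U_def by linarith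
  qed
  then obtain x where x: "x \<in> space PX" "1 - \<epsilon> \<le> measure T (Pair x -` E)" by blast
  note Dx = measurable_compose_Pair1[OF x(1) D]
  have [measurable]: "Measurable.pred PW (D x)" using Dx by simp
  \<comment> \<open>The new region consists of undecoded outputs only, so the regions of the earlier
    codewords stay as they are.\<close>
  define dec' where "dec' w = (if dec w = 0 \<and> D x w then Suc M else dec w)" for w
  have dec' [measurable]: "dec' \<in> measurable PW (count_space UNIV)" unfolding dec'_def by measurable
  have "measure PW {w \<in> space PW. dec' w \<noteq> 0}
      \<le> measure PW (U \<union> {w \<in> space PW. D x w})"
    by (rule W.finite_measure_mono) (auto simp: dec'_def U_def)
  also have "\<dots> \<le> measure PW U + measure PW {w \<in> space PW. D x w}"
    by (rule measure_Un_le) measurable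
  also have "\<dots> \<le> real M * g + g" using dec_g g[OF x(1)] U_def by simp
  finally have dec'_g: "measure PW {w \<in> space PW. dec' w \<noteq> 0} \<le> real (Suc M) * g"
    by (simp add: algebra_simps)
  have "1 - \<epsilon> \<le> measure T {t \<in> space T. dec' (h ((c(Suc M := x)) m) t) = m}"
    if m: "m \<in> {1..Suc M}" for m
  proof (cases "m = Suc M")
    case True
    have "{t \<in> space T. dec' (h x t) = Suc M} = Pair x -` E"
      using x(1) hs dec_le by (fastforce simp: E_def U_def dec'_def space_pair_measure split: if_splits)
    then show ?thesis using x True by simp
  next
    case False
    then have m: "m \<in> {1..M}" using m by auto
    then have "{t \<in> space T. dec' (h (c m) t) = m} = {t \<in> space T. dec (h (c m) t) = m}"
      by (auto simp: dec'_def)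
    then show ?thesis using False err[OF m] by simp
  qed
  moreover have "\<forall>m\<in>{1..Suc M}. (c(Suc M := x)) m \<in> space PX" using c x(1) by auto
  moreover have "\<forall>w\<in>space PW. dec' w \<le> Suc M" using dec_le by (auto simp: dec'_def le_SucI)
  ultimately show ?case using dec' dec'_g by blast
qed

section \<open>Error probability and converse\<close>

lemma buffer_Suc: "buffer y x (Suc i) = (\<Sum>j\<in>{1..i}. y j - (x j)\<^sup>2)"
  by (induction i) auto

definition received :: "nat \<Rightarrow> encoder \<Rightarrow> nat \<Rightarrow> (nat \<Rightarrow> real) \<times> (nat \<Rightarrow> real) \<Rightarrow> nat \<Rightarrow> real" where
  "received n enc m p = (\<lambda>i\<in>{1..n}. channel_input enc m (fst p) i + snd p i)"

definition decoded_event ::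
    "real measure \<Rightarrow> real \<Rightarrow> nat \<Rightarrow> encoder \<Rightarrow> decoder \<Rightarrow> nat \<Rightarrow> ((nat \<Rightarrow> real) \<times> (nat \<Rightarrow> real)) set" where
  "decoded_event D \<sigma> n enc dec m =
     {p \<in> space ((\<Pi>\<^sub>M i\<in>{1..n}. D) \<Otimes>\<^sub>M (\<Pi>\<^sub>M i\<in>{1..n}. gauss \<sigma>)). dec (received n enc m p) = m}"

lemma received_measurable:
  assumes D: "sets D = sets borel"
    and enc: "\<And>i. i \<in> {1..n} \<Longrightarrow> enc m i \<in> borel_measurable (\<Pi>\<^sub>M j\<in>{1..i}. borel)"
  shows "received n enc m \<in> measurable ((\<Pi>\<^sub>M i\<in>{1..n}. D) \<Otimes>\<^sub>M (\<Pi>\<^sub>M i\<in>{1..n}. gauss \<sigma>)) (\<Pi>\<^sub>M i\<in>{1..n}. borel)"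
  unfolding received_def
proof (rule measurable_restrict)
  fix i assume i: "i \<in> {1..n}"
  have "(\<lambda>y. restrict y {1..i}) \<in> measurable (\<Pi>\<^sub>M i\<in>{1..n}. borel) (\<Pi>\<^sub>M i\<in>{1..i}. borel)"
    by (rule measurable_restrict_subset) (use i in auto)
  also have "measurable (\<Pi>\<^sub>M i\<in>{1..n}. borel) (\<Pi>\<^sub>M i\<in>{1..i}. borel :: real measure)
      = measurable (\<Pi>\<^sub>M i\<in>{1..n}. D) (\<Pi>\<^sub>M i\<in>{1..i}. borel)"
    by (intro measurable_cong_sets sets_PiM_cong) (auto simp: D)
  finally have "(\<lambda>y. enc m i (restrict y {1..i})) \<in> borel_measurable (\<Pi>\<^sub>M i\<in>{1..n}. D)"
    using enc[OF i] by (rule measurable_compose)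
  then have [measurable]: "(\<lambda>y. channel_input enc m y i) \<in> borel_measurable (\<Pi>\<^sub>M i\<in>{1..n}. D)"
    by (simp add: channel_input_def)
  have "(\<lambda>z. z i) \<in> measurable (\<Pi>\<^sub>M i\<in>{1..n}. gauss \<sigma>) (gauss \<sigma>)"
    by (rule measurable_component_singleton[OF i])
  then have [measurable]: "(\<lambda>z. z i) \<in> borel_measurable (\<Pi>\<^sub>M i\<in>{1..n}. gauss \<sigma>)" by simp
  show "(\<lambda>p. channel_input enc m (fst p) i + snd p i)
      \<in> borel_measurable ((\<Pi>\<^sub>M i\<in>{1..n}. D) \<Otimes>\<^sub>M (\<Pi>\<^sub>M i\<in>{1..n}. gauss \<sigma>))"
    by measurable
qed

lemma decoded_event_measurable:
  assumes D: "sets D = sets borel" and code: "eh_code n M enc dec" and m: "m \<in> {1..M}"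
  shows "decoded_event D \<sigma> n enc dec m \<in> sets ((\<Pi>\<^sub>M i\<in>{1..n}. D) \<Otimes>\<^sub>M (\<Pi>\<^sub>M i\<in>{1..n}. gauss \<sigma>))"
proof -
  have [measurable]: "received n enc m \<in> measurable ((\<Pi>\<^sub>M i\<in>{1..n}. D) \<Otimes>\<^sub>M (\<Pi>\<^sub>M i\<in>{1..n}. gauss \<sigma>)) (\<Pi>\<^sub>M i\<in>{1..n}. borel)"
    by (rule received_measurable[OF D]) (use code m in \<open>auto simp: eh_code_def\<close>)
  have "dec \<in> measurable (\<Pi>\<^sub>M j\<in>{1..n}. borel) (count_space {1..M})"
    using code by (simp add: eh_code_def)
  from measurable_compose[OF this, of "\<lambda>m. m" "count_space UNIV"]
  have [measurable]: "dec \<in> measurable (\<Pi>\<^sub>M j\<in>{1..n}. borel) (count_space UNIV)" by simp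
  show ?thesis unfolding decoded_event_def by measurable
qed

text \<open>The complement of the error event is the disjoint union of the slices
  \<open>{m} \<times> ?G m\<close>, each of mass \<open>1 / real M\<close> times a conditional
  success probability. Both the converse and the greedy construction speak about these success
  probabilities.\<close>

lemma eh_error_prob_eq:
  assumes "prob_space D" and D: "sets D = sets borel" and \<sigma>: "0 < \<sigma>" and code: "eh_code n M enc dec"
  shows "eh_error_prob D \<sigma> n M enc dec = 1 - (\<Sum>m\<in>{1..M}.
    measure ((\<Pi>\<^sub>M i\<in>{1..n}. D) \<Otimes>\<^sub>M (\<Pi>\<^sub>M i\<in>{1..n}. gauss \<sigma>)) (decoded_event D \<sigma> n enc dec m)) / real M"
proof -
  let ?Q = "(\<Pi>\<^sub>M i\<in>{1..n}. D) \<Otimes>\<^sub>M (\<Pi>\<^sub>M i\<in>{1..n}. gauss \<sigma>)" and ?U = "uniform_count_measure {1..M}"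
  let ?G = "decoded_event D \<sigma> n enc dec"
  have M: "1 \<le> M" using code by (simp add: eh_code_def)
  interpret Q: prob_space ?Q
    by (intro prob_space_pair prob_space_PiM assms prob_space_gauss)
  interpret U: prob_space ?U
    by (rule prob_space_uniform_count_measure) (use M in auto)
  have G: "?G m \<in> sets ?Q" if "m \<in> {1..M}" for m
    by (rule decoded_event_measurable[OF D code that])
  interpret L: prob_space "?U \<Otimes>\<^sub>M ?Q"
    by (intro prob_space_pair U.prob_space_axioms Q.prob_space_axioms)
  let ?S = "\<Union>m\<in>{1..M}. {m} \<times> ?G m"
  have sets: "{m} \<times> ?G m \<in> sets (?U \<Otimes>\<^sub>M ?Q)" if "m \<in> {1..M}" for m
    using that G by (intro pair_measureI) (auto simp: sets_uniform_count_measure)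
  have "measure (?U \<Otimes>\<^sub>M ?Q) ?S = (\<Sum>m\<in>{1..M}. measure (?U \<Otimes>\<^sub>M ?Q) ({m} \<times> ?G m))"
    by (rule L.finite_measure_finite_Union) (use sets in \<open>auto simp: disjoint_family_on_def\<close>)
  also have "\<dots> = (\<Sum>m\<in>{1..M}. 1 / real M * measure ?Q (?G m))"
  proof (intro sum.cong refl)
    fix m assume m: "m \<in> {1..M}"
    have "emeasure (?U \<Otimes>\<^sub>M ?Q) ({m} \<times> ?G m) = emeasure ?U {m} * emeasure ?Q (?G m)"
      using m G by (intro Q.emeasure_pair_measure_Times) (auto simp: sets_uniform_count_measure)
    then have "measure (?U \<Otimes>\<^sub>M ?Q) ({m} \<times> ?G m) = measure ?U {m} * measure ?Q (?G m)"
      by (simp add: measure_def enn2real_mult)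
    also have "measure ?U {m} = 1 / real M"
      using m by (subst measure_uniform_count_measure) auto
    finally show "measure (?U \<Otimes>\<^sub>M ?Q) ({m} \<times> ?G m) = 1 / real M * measure ?Q (?G m)" .
  qed
  also have "\<dots> = (\<Sum>m\<in>{1..M}. measure ?Q (?G m)) / real M"
    by (simp add: sum_divide_distrib)
  finally have S: "measure (?U \<Otimes>\<^sub>M ?Q) ?S = (\<Sum>m\<in>{1..M}. measure ?Q (?G m)) / real M" .
  have "?S \<in> sets (?U \<Otimes>\<^sub>M ?Q)" using sets by (intro sets.finite_UN) auto
  moreover have "{(m, y, z) \<in> space (eh_channel_law D \<sigma> n M).
          dec (\<lambda>i\<in>{1..n}. channel_input enc m y i + z i) \<noteq> m} = space (?U \<Otimes>\<^sub>M ?Q) - ?S"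
    by (auto simp: eh_channel_law_def space_pair_measure decoded_event_def received_def
        space_uniform_count_measure)
  ultimately show ?thesis
    using L.prob_compl[of ?S] S by (simp add: eh_error_prob_def eh_channel_law_def)
qed

section \<open>Converse: a finite bound on the code size\<close>

text \<open>A single symbol cannot cost more than everything harvested so far, hence not more than
  the harvest of the whole block.\<close>

lemma channel_input_bound:
  assumes code: "eh_code n M enc dec" and m: "m \<in> {1..M}" and i: "i \<in> {1..n}"
    and y: "\<And>j. j \<in> {1..n} \<Longrightarrow> 0 \<le> y j"
  shows "(channel_input enc m y i)\<^sup>2 \<le> (\<Sum>j\<in>{1..n}. y j)"
proof -
  \<comment> \<open>\<open>eh_code\<close> constrains the encoder only for energies non-negative at
    every index, whereas \<open>y\<close> is controlled on \<open>{1..n}\<close> alone. Extending by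
    0 repairs this, and by causality the inputs up to time \<open>n\<close> do not change.\<close>
  define y' where "y' j = (if j \<in> {1..n} then y j else 0)" for j
  have eq: "channel_input enc m y' j = channel_input enc m y j" if "j \<in> {1..n}" for j
  proof -
    have "restrict y' {1..j} = restrict y {1..j}" using that by (auto simp: y'_def restrict_def)
    then show ?thesis by (simp add: channel_input_def)
  qed
  obtain k where k: "i = Suc k" using i by (cases i) auto
  have "\<forall>j. 0 \<le> y' j" using y by (simp add: y'_def)
  then have "(channel_input enc m y' i)\<^sup>2 \<le> buffer y' (channel_input enc m y') i + y' i"
    using code m i unfolding eh_code_def by blast
  also have "\<dots> \<le> (\<Sum>j\<in>{1..k}. y' j) + y' i"
    unfolding k buffer_Suc by (intro add_right_mono sum_mono) simp
  also have "\<dots> = (\<Sum>j\<in>{1..i}. y' j)" by (simp add: k)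
  also have "\<dots> \<le> (\<Sum>j\<in>{1..n}. y' j)"
    by (rule sum_mono2) (use i y in \<open>auto simp: y'_def\<close>)
  also have "\<dots> = (\<Sum>j\<in>{1..n}. y j)" by (simp add: y'_def)
  finally show ?thesis using eq[OF i] by simp
qed

text \<open>Domination of measures by a constant multiple tensorizes. Phrased through integrals, the
  hypothesis can be applied to one coordinate at a time inside Fubini's theorem.\<close>

lemma nn_integral_PiM_le:
  assumes \<mu>: "\<And>i. prob_space (\<mu> i)" and \<nu>: "\<And>i. prob_space (\<nu> i)"
    and sets: "\<And>i. sets (\<mu> i) = sets (\<nu> i)"
    and le: "\<And>i f. i \<in> I \<Longrightarrow> f \<in> borel_measurable (\<nu> i) \<Longrightarrow>
        (\<integral>\<^sup>+x. f x \<partial>\<mu> i) \<le> c * (\<integral>\<^sup>+x. f x \<partial>\<nu> i)"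
    and "finite I" and "f \<in> borel_measurable (Pi\<^sub>M I \<nu>)"
  shows "(\<integral>\<^sup>+x. f x \<partial>Pi\<^sub>M I \<mu>) \<le> c ^ card I * (\<integral>\<^sup>+x. f x \<partial>Pi\<^sub>M I \<nu>)"
  using \<open>finite I\<close> \<open>f \<in> borel_measurable (Pi\<^sub>M I \<nu>)\<close> le
proof (induction I arbitrary: f rule: finite_induct)
  case empty
  have "Pi\<^sub>M {} \<mu> = Pi\<^sub>M {} \<nu>" by (rule PiM_cong) auto
  then show ?case by simp
next
  case (insert i I)
  interpret \<mu>: product_sigma_finite \<mu>
    by (simp add: product_sigma_finite_def \<mu> prob_space_imp_sigma_finite)
  interpret \<nu>: product_sigma_finite \<nu>
    by (simp add: product_sigma_finite_def \<nu> prob_space_imp_sigma_finite)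
  note meas [measurable] = insert.prems(1)
  have f\<mu>: "f \<in> borel_measurable (Pi\<^sub>M (insert i I) \<mu>)"
    using meas by (subst measurable_cong_sets[OF sets_PiM_cong[OF refl sets] refl])
  have inner [measurable]: "(\<lambda>x. \<integral>\<^sup>+y. f (x(i := y)) \<partial>\<nu> i) \<in> borel_measurable (Pi\<^sub>M I \<nu>)"
    by (rule \<nu>.borel_measurable_nn_integral) measurable
  have inner': "(\<lambda>x. \<integral>\<^sup>+y. f (x(i := y)) \<partial>\<nu> i) \<in> borel_measurable (Pi\<^sub>M I \<mu>)"
    using inner by (subst measurable_cong_sets[OF sets_PiM_cong[OF refl sets] refl])
  have "(\<integral>\<^sup>+x. f x \<partial>Pi\<^sub>M (insert i I) \<mu>) = (\<integral>\<^sup>+x. \<integral>\<^sup>+y. f (x(i := y)) \<partial>\<mu> i \<partial>Pi\<^sub>M I \<mu>)"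
    by (rule \<mu>.product_nn_integral_insert[OF insert.hyps f\<mu>])
  also have "\<dots> \<le> (\<integral>\<^sup>+x. c * (\<integral>\<^sup>+y. f (x(i := y)) \<partial>\<nu> i) \<partial>Pi\<^sub>M I \<mu>)"
  proof (intro nn_integral_mono insert.prems(2))
    fix x assume "x \<in> space (Pi\<^sub>M I \<mu>)"
    then have "x \<in> space (Pi\<^sub>M I \<nu>)" by (simp add: space_PiM sets_eq_imp_space_eq[OF sets])
    then show "(\<lambda>y. f (x(i := y))) \<in> borel_measurable (\<nu> i)" by measurable
  qed simp
  also have "\<dots> = c * (\<integral>\<^sup>+x. (\<integral>\<^sup>+y. f (x(i := y)) \<partial>\<nu> i) \<partial>Pi\<^sub>M I \<mu>)"
    by (rule nn_integral_cmult[OF inner'])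
  also have "\<dots> \<le> c * (c ^ card I * (\<integral>\<^sup>+x. (\<integral>\<^sup>+y. f (x(i := y)) \<partial>\<nu> i) \<partial>Pi\<^sub>M I \<nu>))"
    by (intro mult_left_mono insert.IH inner insert.prems(2)) auto
  also have "\<dots> = c ^ card (insert i I) * (\<integral>\<^sup>+x. f x \<partial>Pi\<^sub>M (insert i I) \<nu>)"
    using insert.hyps by (simp add: \<nu>.product_nn_integral_insert mult.assoc)
  finally show ?case .
qed

text \<open>Doubling the variance makes one centred Gaussian dominate all bounded shifts: the square
  of \<open>w\<close> is at most twice the sum of the squares of \<open>w - x\<close> and
  \<open>x\<close>. The factor \<open>sqrt 2\<close> is the ratio of the normalising
  constants.\<close>

lemma nn_integral_shifted_gauss_le:
  assumes [arith]: "0 < \<sigma>" and x: "x\<^sup>2 \<le> K" and [measurable]: "f \<in> borel_measurable borel"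
  shows "(\<integral>\<^sup>+w. f w \<partial>distr (gauss \<sigma>) borel (\<lambda>z. x + z))
    \<le> ennreal (sqrt 2 * exp (K / (2 * \<sigma>\<^sup>2))) * (\<integral>\<^sup>+w. f w \<partial>gauss (sqrt 2 * \<sigma>))"
proof -
  let ?B = "sqrt 2 * exp (K / (2 * \<sigma>\<^sup>2))"
  have dens: "normal_density x \<sigma> w \<le> ?B * normal_density 0 (sqrt 2 * \<sigma>) w" for w
  proof -
    have "0 \<le> (w - 2 * x)\<^sup>2" by simp
    then have "w\<^sup>2 \<le> 2 * ((w - x)\<^sup>2 + x\<^sup>2)" by (simp add: power2_eq_square algebra_simps)
    also have "\<dots> \<le> 2 * ((w - x)\<^sup>2 + K)" using x by simp
    finally have "- (w - x)\<^sup>2 / (2 * \<sigma>\<^sup>2) \<le> K / (2 * \<sigma>\<^sup>2) + - w\<^sup>2 / (2 * (sqrt 2 * \<sigma>)\<^sup>2)"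
      by (simp add: field_simps)
    then have "exp (- (w - x)\<^sup>2 / (2 * \<sigma>\<^sup>2)) \<le> exp (K / (2 * \<sigma>\<^sup>2)) * exp (- w\<^sup>2 / (2 * (sqrt 2 * \<sigma>)\<^sup>2))"
      by (simp only: exp_add[symmetric] exp_le_cancel_iff)
    then have "1 / sqrt (2 * pi * \<sigma>\<^sup>2) * exp (- (w - x)\<^sup>2 / (2 * \<sigma>\<^sup>2))
        \<le> 1 / sqrt (2 * pi * \<sigma>\<^sup>2) * (exp (K / (2 * \<sigma>\<^sup>2)) * exp (- w\<^sup>2 / (2 * (sqrt 2 * \<sigma>)\<^sup>2)))"
      by (intro mult_left_mono) auto
    also have "\<dots> = ?B * normal_density 0 (sqrt 2 * \<sigma>) w"
    proof -
      have "sqrt (2 * pi * (sqrt 2 * \<sigma>)\<^sup>2) = sqrt 2 * sqrt (2 * pi * \<sigma>\<^sup>2)"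
        by (subst real_sqrt_mult[symmetric]) (simp add: power_mult_distrib ac_simps)
      then show ?thesis unfolding normal_density_def by simp
    qed
    finally show ?thesis by (simp add: normal_density_def)
  qed
  have "(\<integral>\<^sup>+w. f w \<partial>distr (gauss \<sigma>) borel (\<lambda>z. x + z)) = (\<integral>\<^sup>+z. ennreal (normal_density 0 \<sigma> z) * f (x + z) \<partial>lborel)"
    by (simp add: nn_integral_distr nn_integral_density)
  also have "\<dots> = (\<integral>\<^sup>+w. ennreal (normal_density x \<sigma> w) * f w \<partial>lborel)"
    by (subst nn_integral_real_affine[where c = 1 and t = x]) (auto simp: normal_density_def)
  also have "\<dots> \<le> (\<integral>\<^sup>+w. ennreal ?B * (ennreal (normal_density 0 (sqrt 2 * \<sigma>) w) * f w) \<partial>lborel)"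
    unfolding mult.assoc[symmetric]
    by (intro nn_integral_mono mult_right_mono) (auto simp: ennreal_mult'[symmetric] dens intro!: ennreal_leI)
  also have "\<dots> = ennreal ?B * (\<integral>\<^sup>+w. f w \<partial>gauss (sqrt 2 * \<sigma>))"
    by (simp add: nn_integral_cmult nn_integral_density)
  finally show ?thesis .
qed

lemma prob_space_tail_le:
  fixes f :: "'a \<Rightarrow> real"
  assumes "prob_space M" and [measurable]: "f \<in> borel_measurable M" and "0 < (\<delta>::real)"
  shows "\<exists>K\<ge>0. measure M {x \<in> space M. K < f x} \<le> \<delta>"
proof -
  interpret prob_space M by fact
  interpret F: real_distribution "distr M borel f" by (rule real_distribution_distr) simp
  have "\<forall>\<^sub>F K in at_top. 1 - \<delta> < cdf (distr M borel f) K"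
    using F.cdf_lim_at_top_prob \<open>0 < \<delta>\<close> by (intro order_tendstoD(1)) auto
  then have "\<forall>\<^sub>F K in at_top. 0 \<le> K \<and> 1 - \<delta> < cdf (distr M borel f) K"
    using eventually_ge_at_top by (rule eventually_conj[rotated])
  then obtain K where K: "0 \<le> K" "1 - \<delta> < cdf (distr M borel f) K"
    using eventually_happens'[OF trivial_limit_at_top_linorder] by blast
  have "cdf (distr M borel f) K = prob {x \<in> space M. f x \<le> K}"
    by (auto simp: cdf_def measure_distr intro!: arg_cong[where f = prob])
  moreover have "prob {x \<in> space M. K < f x} = 1 - prob {x \<in> space M. f x \<le> K}"
    by (subst prob_compl[symmetric]) (auto intro!: arg_cong[where f = prob])
  ultimately show ?thesis using K by (intro exI[of _ K]) auto
qed

text \<open>Off the event of a large harvest, success for message \<open>m\<close> has probability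
  at most \<open>c ^ n\<close> times the \<open>?Q\<close>-mass of its decoding region. The regions
  are disjoint, so these bounds sum to at most \<open>c ^ n\<close>, whatever \<open>M\<close> is.
  The bound may grow with \<open>n\<close>: it only has to make \<open>GREATEST\<close> meaningful
  for each blocklength.\<close>

lemma eh_code_size_bounded:
  assumes PD: "prob_space D" and D: "sets D = sets borel" and pos: "AE y in D. 0 \<le> y"
    and \<sigma>: "0 < \<sigma>" and \<epsilon>: "\<epsilon> < 1"
  shows "\<exists>b. \<forall>M. (\<exists>enc dec. eh_code n M enc dec \<and> eh_error_prob D \<sigma> n M enc dec \<le> \<epsilon>) \<longrightarrow> M \<le> b"
proof -
  let ?PY = "\<Pi>\<^sub>M i\<in>{1..n}. D" and ?PZ = "\<Pi>\<^sub>M i\<in>{1..n}. gauss \<sigma>"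
    and ?Q = "\<Pi>\<^sub>M i\<in>{1..n}. gauss (sqrt 2 * \<sigma>)"
  interpret PY: prob_space ?PY by (intro prob_space_PiM PD)
  interpret PZ: prob_space ?PZ by (intro prob_space_PiM prob_space_gauss \<sigma>)
  interpret PYZ: prob_space "?PY \<Otimes>\<^sub>M ?PZ"
    by (intro prob_space_pair PY.prob_space_axioms PZ.prob_space_axioms)
  interpret Q: prob_space ?Q by (intro prob_space_PiM prob_space_gauss) (simp add: \<sigma>)
  have [measurable]: "(\<lambda>y. y i) \<in> borel_measurable ?PY" if "i \<in> {1..n}" for i
    using measurable_component_singleton[OF that, of "\<lambda>_. D"]
    by (simp cong: measurable_cong_sets add: D)
  \<comment> \<open>The large-harvest event gets half of the guaranteed success probability
    \<open>1 - \<epsilon>\<close>; its contribution \<open>real M * ((1 - \<epsilon>) / 2)\<close>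
    can then be subtracted from \<open>real M * (1 - \<epsilon>)\<close>, leaving a positive
    multiple of \<open>M\<close>.\<close>
  obtain K where K: "0 \<le> K" "measure ?PY {y \<in> space ?PY. K < (\<Sum>j\<in>{1..n}. y j)} \<le> (1 - \<epsilon>) / 2"
    using prob_space_tail_le[OF PY.prob_space_axioms, of "\<lambda>y. \<Sum>j\<in>{1..n}. y j" "(1 - \<epsilon>) / 2"] \<epsilon> by auto
  let ?bad = "{y \<in> space ?PY. K < (\<Sum>j\<in>{1..n}. y j)}"
  define c where "c = sqrt 2 * exp (K / (2 * \<sigma>\<^sup>2))"
  have "0 \<le> c" by (simp add: c_def)
  have AEpos: "AE y in ?PY. \<forall>j\<in>{1..n}. 0 \<le> y j"
    by (rule AE_finite_allI) (auto intro!: AE_PiM_component PD pos)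
  have "M \<le> nat \<lceil>2 * c ^ n / (1 - \<epsilon>)\<rceil>"
    if code: "eh_code n M enc dec" and err: "eh_error_prob D \<sigma> n M enc dec \<le> \<epsilon>" for M enc dec
  proof -
    let ?G = "decoded_event D \<sigma> n enc dec"
    have M: "1 \<le> M" using code by (simp add: eh_code_def)
    have G [measurable]: "?G m \<in> sets (?PY \<Otimes>\<^sub>M ?PZ)" if "m \<in> {1..M}" for m
      by (rule decoded_event_measurable[OF D code that])
    have decm: "dec \<in> measurable (\<Pi>\<^sub>M j\<in>{1..n}. borel) (count_space {1..M})"
      using code by (simp add: eh_code_def)
    define R where "R m = dec -` {m} \<inter> space (\<Pi>\<^sub>M j\<in>{1..n}. borel :: real measure)" for m
    have R: "R m \<in> sets (\<Pi>\<^sub>M j\<in>{1..n}. borel)" if "m \<in> {1..M}" for m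
      unfolding R_def by (rule measurable_sets[OF decm]) (use that in auto)
    have RQ: "R m \<in> sets ?Q" if "m \<in> {1..M}" for m
      using R[OF that] by (simp cong: sets_PiM_cong)
    have slice: "emeasure ?PZ (Pair y -` ?G m) \<le> ennreal (c ^ n) * emeasure ?Q (R m)"
      if m: "m \<in> {1..M}" and y: "y \<in> space ?PY" "\<forall>j\<in>{1..n}. 0 \<le> y j" "(\<Sum>j\<in>{1..n}. y j) \<le> K" for m y
    proof -
      let ?x = "channel_input enc m y"
      have x: "(?x i)\<^sup>2 \<le> K" if "i \<in> {1..n}" for i
        using channel_input_bound[OF code m that, of y] y by force
      have shift: "distr ?PZ (\<Pi>\<^sub>M j\<in>{1..n}. borel) (\<lambda>z. \<lambda>i\<in>{1..n}. ?x i + z i)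
          = (\<Pi>\<^sub>M i\<in>{1..n}. distr (gauss \<sigma>) borel (\<lambda>z. ?x i + z))"
        by (rule distr_PiM_componentwise) (auto intro: prob_space_gauss \<sigma>)
      have meas: "(\<lambda>z. \<lambda>i\<in>{1..n}. ?x i + z i) \<in> measurable ?PZ (\<Pi>\<^sub>M j\<in>{1..n}. borel)"
        by (intro measurable_restrict borel_measurable_add borel_measurable_const)
          (metis measurable_component_singleton measurable_cong_sets sets_density sets_lborel)
      have "Pair y -` ?G m = (\<lambda>z. \<lambda>i\<in>{1..n}. ?x i + z i) -` R m \<inter> space ?PZ"
        using y(1) by (auto simp: decoded_event_def received_def R_def space_pair_measure space_PiM)
      then have "emeasure ?PZ (Pair y -` ?G m)
          = emeasure (\<Pi>\<^sub>M i\<in>{1..n}. distr (gauss \<sigma>) borel (\<lambda>z. ?x i + z)) (R m)"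
        unfolding shift[symmetric] using meas R[OF m] by (simp add: emeasure_distr)
      also have "\<dots> = (\<integral>\<^sup>+w. indicator (R m) w \<partial>(\<Pi>\<^sub>M i\<in>{1..n}. distr (gauss \<sigma>) borel (\<lambda>z. ?x i + z)))"
        using R[OF m] by (subst nn_integral_indicator) (simp_all cong: sets_PiM_cong)
      also have "\<dots> \<le> ennreal c ^ card {1..n} * (\<integral>\<^sup>+w. indicator (R m) w \<partial>?Q)"
      proof (rule nn_integral_PiM_le)
        fix i :: nat and f :: "real \<Rightarrow> ennreal" assume "i \<in> {1..n}" "f \<in> borel_measurable (gauss (sqrt 2 * \<sigma>))"
        then show "(\<integral>\<^sup>+w. f w \<partial>distr (gauss \<sigma>) borel (\<lambda>z. ?x i + z)) \<le> ennreal c * (\<integral>\<^sup>+w. f w \<partial>gauss (sqrt 2 * \<sigma>))"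
          unfolding c_def by (intro nn_integral_shifted_gauss_le \<sigma> x) auto
      next
        show "prob_space (distr (gauss \<sigma>) borel (\<lambda>z. ?x i + z))" for i
          by (rule prob_space.prob_space_distr[OF prob_space_gauss[OF \<sigma>]]) simp
      qed (use RQ[OF m] \<sigma> in \<open>auto intro: prob_space_gauss\<close>)
      finally show ?thesis using RQ[OF m] \<open>0 \<le> c\<close> by (simp add: ennreal_power)
    qed
    have "ennreal (\<Sum>m\<in>{1..M}. measure (?PY \<Otimes>\<^sub>M ?PZ) (?G m)) = (\<Sum>m\<in>{1..M}. emeasure (?PY \<Otimes>\<^sub>M ?PZ) (?G m))"
      by (simp add: PYZ.emeasure_eq_measure sum_nonneg flip: sum_ennreal)
    also have "\<dots> = (\<Sum>m\<in>{1..M}. \<integral>\<^sup>+y. emeasure ?PZ (Pair y -` ?G m) \<partial>?PY)"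
      by (intro sum.cong refl PZ.emeasure_pair_measure_alt G)
    also have "\<dots> = (\<integral>\<^sup>+y. (\<Sum>m\<in>{1..M}. emeasure ?PZ (Pair y -` ?G m)) \<partial>?PY)"
      by (intro nn_integral_sum[symmetric] PZ.measurable_emeasure_Pair G)
    also have "\<dots> \<le> (\<integral>\<^sup>+y. ennreal (c ^ n) + ennreal (real M) * indicator ?bad y \<partial>?PY)"
    proof (rule nn_integral_mono_AE, use AEpos in eventually_elim)
      fix y :: "nat \<Rightarrow> real" assume y: "\<forall>j\<in>{1..n}. 0 \<le> y j"
      show "(\<Sum>m\<in>{1..M}. emeasure ?PZ (Pair y -` ?G m)) \<le> ennreal (c ^ n) + ennreal (real M) * indicator ?bad y"
      proof (cases "y \<in> space ?PY")
        case False
        then have "Pair y -` ?G m = {}" for m by (auto simp: decoded_event_def space_pair_measure)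
        then show ?thesis by simp
      next
        case sp: True
        show ?thesis
        proof (cases "y \<in> ?bad")
          case True
          have "(\<Sum>m\<in>{1..M}. emeasure ?PZ (Pair y -` ?G m)) \<le> (\<Sum>m\<in>{1..M}. 1)"
            by (intro sum_mono PZ.emeasure_le_1)
          also have "\<dots> = ennreal (real M)" by (simp add: ennreal_of_nat_eq_real_of_nat)
          finally show ?thesis using True by (simp add: add_increasing)
        next
          case False
          then have "(\<Sum>m\<in>{1..M}. emeasure ?PZ (Pair y -` ?G m)) \<le> (\<Sum>m\<in>{1..M}. ennreal (c ^ n) * emeasure ?Q (R m))"
            using sp y by (intro sum_mono slice) auto
          also have "\<dots> = ennreal (c ^ n) * emeasure ?Q (\<Union>m\<in>{1..M}. R m)"
            unfolding sum_distrib_left[symmetric]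
            by (subst sum_emeasure) (use RQ in \<open>auto simp: disjoint_family_on_def R_def\<close>)
          also have "\<dots> \<le> ennreal (c ^ n) * 1" by (intro mult_left_mono Q.emeasure_le_1) auto
          finally show ?thesis using False by simp
        qed
      qed
    qed
    also have "\<dots> = ennreal (c ^ n) + ennreal (real M) * emeasure ?PY ?bad"
      by (subst nn_integral_add) (auto simp: PY.emeasure_space_1 nn_integral_cmult_indicator)
    also have "\<dots> \<le> ennreal (c ^ n) + ennreal (real M) * ennreal ((1 - \<epsilon>) / 2)"
      using K(2) by (intro add_left_mono mult_left_mono) (auto simp: PY.emeasure_eq_measure ennreal_leI)
    also have "\<dots> = ennreal (c ^ n + real M * ((1 - \<epsilon>) / 2))"
      using \<epsilon> \<open>0 \<le> c\<close> by (simp add: ennreal_mult'[symmetric] ennreal_plus[symmetric] del: ennreal_plus)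
    finally have "(\<Sum>m\<in>{1..M}. measure (?PY \<Otimes>\<^sub>M ?PZ) (?G m)) \<le> c ^ n + real M * ((1 - \<epsilon>) / 2)"
      using \<epsilon> \<open>0 \<le> c\<close> by (subst (asm) ennreal_le_iff) auto
    moreover have "real M * (1 - \<epsilon>) \<le> (\<Sum>m\<in>{1..M}. measure (?PY \<Otimes>\<^sub>M ?PZ) (?G m))"
      using err M unfolding eh_error_prob_eq[OF PD D \<sigma> code] by (simp add: field_simps)
    ultimately have "real M * ((1 - \<epsilon>) / 2) \<le> c ^ n" by (simp add: field_simps)
    then have "real M \<le> 2 * c ^ n / (1 - \<epsilon>)" using \<epsilon> by (simp add: field_simps)
    then show ?thesis by linarith
  qed
  then show ?thesis by blast
qed

section \<open>The law of one letter\<close>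

text \<open>The mean harvest is written as a square so that Gaussian symbols of deviation
  \<open>\<nu>\<close> spend on average exactly what is harvested. Positivity of
  \<open>\<nu>\<close> makes the input law a genuine normal density.\<close>

locale gaussian_input =
  fixes D :: "real measure" and \<nu> \<sigma> :: real
  assumes prob_D: "prob_space D" and sets_D: "sets D = sets borel"
    and square_integrable_D: "integrable D (\<lambda>y. y\<^sup>2)" and mean_D: "(\<integral>y. y \<partial>D) = \<nu>\<^sup>2"
    and \<nu>_pos: "0 < \<nu>" and \<sigma>_pos: "0 < \<sigma>"
begin

definition \<tau> :: real where "\<tau> = sqrt (\<nu>\<^sup>2 + \<sigma>\<^sup>2)"

text \<open>A letter is a triple of codeword symbol, harvested energy and noise. The flag \<open>silent\<close> marks the
  times of the initial saving phase, in which \<open>0\<close> is sent whatever the codeword symbol; keeping a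
  symbol there as well makes the letters identically distributed.\<close>

definition letter :: "(real \<times> real \<times> real) measure" where
  "letter = gauss \<nu> \<Otimes>\<^sub>M (D \<Otimes>\<^sub>M gauss \<sigma>)"

text \<open>In the saving phase the harvest is centred by its mean, not by the energy spent, which
  is 0. So the mean is zero in both phases, and the amounts subtracted while silent add up to the
  reserve used in \<open>delayed_admissible\<close>.\<close>

definition energy_dev :: "bool \<Rightarrow> real \<times> real \<times> real \<Rightarrow> real" where
  "energy_dev silent p = fst (snd p) - (if silent then \<nu>\<^sup>2 else (fst p)\<^sup>2)"

text \<open>The information density of one transmitted symbol in nats, minus its mean
  \<open>ln (\<tau> / \<sigma>)\<close>: each of the two quadratic terms has mean 1/2.\<close>

definition info_dev :: "bool \<Rightarrow> real \<times> real \<times> real \<Rightarrow> real" where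
  "info_dev silent p =
     (if silent then 0 else (fst p + snd (snd p))\<^sup>2 / (2 * \<tau>\<^sup>2) - (snd (snd p))\<^sup>2 / (2 * \<sigma>\<^sup>2))"

text \<open>The output of the outage-free channel; it ignores whether the buffer can pay for the
  symbol.\<close>

definition channel_out :: "bool \<Rightarrow> real \<times> real \<times> real \<Rightarrow> real" where
  "channel_out silent p = (if silent then 0 else fst p) + snd (snd p)"

lemma \<tau>_pos: "0 < \<tau>"
  using \<nu>_pos \<sigma>_pos by (simp add: \<tau>_def add_pos_pos)

lemma \<tau>_square: "\<tau>\<^sup>2 = \<nu>\<^sup>2 + \<sigma>\<^sup>2"
  by (simp add: \<tau>_def)

lemma sets_letter: "sets letter = sets (borel \<Otimes>\<^sub>M (borel \<Otimes>\<^sub>M borel))"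
  unfolding letter_def by (intro sets_pair_measure_cong) (auto simp: sets_D)

lemma measurable_letter: "f \<in> measurable (borel \<Otimes>\<^sub>M (borel \<Otimes>\<^sub>M borel)) N \<Longrightarrow> f \<in> measurable letter N"
  using measurable_cong_sets[OF sets_letter refl] by blast

lemma prob_letter: "prob_space letter"
  unfolding letter_def by (intro prob_space_pair prob_space_gauss prob_D \<nu>_pos \<sigma>_pos)

lemma distr_letter_noise: "distr letter borel (\<lambda>p. snd (snd p)) = gauss \<sigma>"
proof -
  interpret D: prob_space D by (rule prob_D)
  interpret \<nu>: prob_space "gauss \<nu>" by (rule prob_space_gauss[OF \<nu>_pos])
  interpret \<sigma>: prob_space "gauss \<sigma>" by (rule prob_space_gauss[OF \<sigma>_pos])
  interpret DG: prob_space "D \<Otimes>\<^sub>M gauss \<sigma>"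
    by (intro prob_space_pair D.prob_space_axioms \<sigma>.prob_space_axioms)
  show ?thesis
  proof (rule measure_eqI)
    fix A assume "A \<in> sets (distr letter borel (\<lambda>p. snd (snd p)))"
    then have A: "A \<in> sets borel" by simp
    have "(\<lambda>p. snd (snd p)) -` A \<inter> space letter = space (gauss \<nu>) \<times> (space D \<times> A)"
      by (auto simp: letter_def space_pair_measure)
    then have "emeasure (distr letter borel (\<lambda>p. snd (snd p))) A
        = emeasure letter (space (gauss \<nu>) \<times> (space D \<times> A))"
      using A by (simp add: emeasure_distr measurable_letter)
    also have "\<dots> = emeasure (gauss \<sigma>) A"
      unfolding letter_def using A \<nu>.emeasure_space_1
      by (simp add: DG.emeasure_pair_measure_Times \<sigma>.emeasure_pair_measure_Times D.emeasure_space_1)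
    finally show "emeasure (distr letter borel (\<lambda>p. snd (snd p))) A = emeasure (gauss \<sigma>) A" .
  qed simp
qed

lemma distr_letter_output: "distr letter borel (\<lambda>p. fst p + snd (snd p)) = gauss \<tau>"
proof -
  interpret D: prob_space D by (rule prob_D)
  interpret \<sigma>: prob_space "gauss \<sigma>" by (rule prob_space_gauss[OF \<sigma>_pos])
  interpret DG: prob_space "D \<Otimes>\<^sub>M gauss \<sigma>"
    by (intro prob_space_pair D.prob_space_axioms \<sigma>.prob_space_axioms)
  have snd: "distr (D \<Otimes>\<^sub>M gauss \<sigma>) (gauss \<sigma>) snd = gauss \<sigma>"
  proof (rule measure_eqI)
    fix A assume "A \<in> sets (distr (D \<Otimes>\<^sub>M gauss \<sigma>) (gauss \<sigma>) snd)"
    then have A: "A \<in> sets (gauss \<sigma>)" by simp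
    have "snd -` A \<inter> space (D \<Otimes>\<^sub>M gauss \<sigma>) = space D \<times> A"
      by (auto simp: space_pair_measure)
    then show "emeasure (distr (D \<Otimes>\<^sub>M gauss \<sigma>) (gauss \<sigma>) snd) A = emeasure (gauss \<sigma>) A"
      using A by (simp add: emeasure_distr \<sigma>.emeasure_pair_measure_Times D.emeasure_space_1)
  qed simp
  have "gauss \<nu> \<Otimes>\<^sub>M gauss \<sigma> = distr (gauss \<nu>) (gauss \<nu>) (\<lambda>x. x) \<Otimes>\<^sub>M distr (D \<Otimes>\<^sub>M gauss \<sigma>) (gauss \<sigma>) snd"
    by (simp add: snd distr_id2)
  also have "\<dots> = distr letter (gauss \<nu> \<Otimes>\<^sub>M gauss \<sigma>) (\<lambda>(x, q). (x, snd q))"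
    unfolding letter_def
    by (rule pair_measure_distr) (auto simp: snd prob_space_imp_sigma_finite \<sigma>.prob_space_axioms)
  finally have "distr (gauss \<nu> \<Otimes>\<^sub>M gauss \<sigma>) borel (\<lambda>(x, z). x + z)
      = distr (distr letter (gauss \<nu> \<Otimes>\<^sub>M gauss \<sigma>) (\<lambda>(x, q). (x, snd q))) borel (\<lambda>(x, z). x + z)" by simp
  also have "\<dots> = distr letter borel ((\<lambda>(x, z). x + z) \<circ> (\<lambda>(x, q). (x, snd q)))"
    by (rule distr_distr) (auto simp: letter_def)
  also have "(\<lambda>(x, z). x + z) \<circ> (\<lambda>(x, q). (x, snd q)) = (\<lambda>p. fst p + snd (snd p :: real \<times> real))"
    by (auto simp: fun_eq_iff)
  finally show ?thesis by (simp add: distr_gauss_add \<nu>_pos \<sigma>_pos \<tau>_def)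
qed

lemma distr_letter_input: "distr letter borel fst = gauss \<nu>"
proof -
  interpret DG: prob_space "D \<Otimes>\<^sub>M gauss \<sigma>"
    by (intro prob_space_pair prob_D prob_space_gauss \<sigma>_pos)
  have "distr letter borel fst = distr letter (gauss \<nu>) fst" by (rule distr_cong) auto
  then show ?thesis by (simp add: letter_def DG.distr_pair_fst)
qed

lemma distr_letter_energy: "distr letter borel (\<lambda>p. fst (snd p)) = D"
proof -
  interpret D: prob_space D by (rule prob_D)
  interpret \<nu>: prob_space "gauss \<nu>" by (rule prob_space_gauss[OF \<nu>_pos])
  interpret \<sigma>: prob_space "gauss \<sigma>" by (rule prob_space_gauss[OF \<sigma>_pos])
  interpret DG: prob_space "D \<Otimes>\<^sub>M gauss \<sigma>"
    by (intro prob_space_pair D.prob_space_axioms \<sigma>.prob_space_axioms)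
  show ?thesis
  proof (rule measure_eqI)
    fix A assume "A \<in> sets (distr letter borel (\<lambda>p. fst (snd p)))"
    then have A: "A \<in> sets borel" by simp
    have "space D = UNIV" using sets_eq_imp_space_eq[OF sets_D] by simp
    then have "(\<lambda>p. fst (snd p)) -` A \<inter> space letter = space (gauss \<nu>) \<times> (A \<times> space (gauss \<sigma>))"
      by (auto simp: letter_def space_pair_measure)
    then have "emeasure (distr letter borel (\<lambda>p. fst (snd p))) A
        = emeasure letter (space (gauss \<nu>) \<times> (A \<times> space (gauss \<sigma>)))"
      using A by (simp add: emeasure_distr measurable_letter)
    also have "\<dots> = emeasure D A"
      unfolding letter_def using A sets_D \<nu>.emeasure_space_1 \<sigma>.emeasure_space_1
      by (simp add: DG.emeasure_pair_measure_Times \<sigma>.emeasure_pair_measure_Times)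
    finally show "emeasure (distr letter borel (\<lambda>p. fst (snd p))) A = emeasure D A" .
  qed (simp add: sets_D)
qed

lemma distr_letter_channel_out:
  "distr letter borel (channel_out silent) = gauss (if silent then \<sigma> else \<tau>)"
  using distr_letter_noise distr_letter_output
  by (cases silent) (simp_all add: channel_out_def[abs_def])

lemma letter_transfer:
  fixes f :: "real \<Rightarrow> real"
  assumes "distr letter borel g = L" and "g \<in> borel_measurable (borel \<Otimes>\<^sub>M (borel \<Otimes>\<^sub>M borel))"
    and "f \<in> borel_measurable borel"
  shows "integrable letter (\<lambda>p. f (g p)) \<longleftrightarrow> integrable L f"
    and "(\<integral>p. f (g p) \<partial>letter) = (\<integral>x. f x \<partial>L)"
  using integrable_distr_eq[OF measurable_letter[OF assms(2)] assms(3)]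
    integral_distr[OF measurable_letter[OF assms(2)] assms(3)] assms(1) by simp_all

lemma letter_input:
  fixes f :: "real \<Rightarrow> real"
  assumes "f \<in> borel_measurable borel"
  shows "integrable (gauss \<nu>) f \<Longrightarrow> integrable letter (\<lambda>p. f (fst p))"
    and "(\<integral>p. f (fst p) \<partial>letter) = (\<integral>x. f x \<partial>gauss \<nu>)"
proof -
  have "(\<lambda>p :: real \<times> real \<times> real. fst p) \<in> borel_measurable (borel \<Otimes>\<^sub>M (borel \<Otimes>\<^sub>M borel))" by measurable
  note letter_transfer[OF distr_letter_input this assms]
  then show "integrable (gauss \<nu>) f \<Longrightarrow> integrable letter (\<lambda>p. f (fst p))"
    and "(\<integral>p. f (fst p) \<partial>letter) = (\<integral>x. f x \<partial>gauss \<nu>)" by blast+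
qed

lemma letter_energy:
  fixes f :: "real \<Rightarrow> real"
  assumes "f \<in> borel_measurable borel"
  shows "integrable (D) f \<Longrightarrow> integrable letter (\<lambda>p. f (fst (snd p)))"
    and "(\<integral>p. f (fst (snd p)) \<partial>letter) = (\<integral>x. f x \<partial>D)"
proof -
  have "(\<lambda>p :: real \<times> real \<times> real. fst (snd p)) \<in> borel_measurable (borel \<Otimes>\<^sub>M (borel \<Otimes>\<^sub>M borel))" by measurable
  note letter_transfer[OF distr_letter_energy this assms]
  then show "integrable (D) f \<Longrightarrow> integrable letter (\<lambda>p. f (fst (snd p)))"
    and "(\<integral>p. f (fst (snd p)) \<partial>letter) = (\<integral>x. f x \<partial>D)" by blast+
qed

lemma letter_noise:
  fixes f :: "real \<Rightarrow> real"
  assumes "f \<in> borel_measurable borel"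
  shows "integrable (gauss \<sigma>) f \<Longrightarrow> integrable letter (\<lambda>p. f (snd (snd p)))"
    and "(\<integral>p. f (snd (snd p)) \<partial>letter) = (\<integral>x. f x \<partial>gauss \<sigma>)"
proof -
  have "(\<lambda>p :: real \<times> real \<times> real. snd (snd p)) \<in> borel_measurable (borel \<Otimes>\<^sub>M (borel \<Otimes>\<^sub>M borel))" by measurable
  note letter_transfer[OF distr_letter_noise this assms]
  then show "integrable (gauss \<sigma>) f \<Longrightarrow> integrable letter (\<lambda>p. f (snd (snd p)))"
    and "(\<integral>p. f (snd (snd p)) \<partial>letter) = (\<integral>x. f x \<partial>gauss \<sigma>)" by blast+
qed

lemma letter_output:
  fixes f :: "real \<Rightarrow> real"
  assumes "f \<in> borel_measurable borel"
  shows "integrable (gauss \<tau>) f \<Longrightarrow> integrable letter (\<lambda>p. f (fst p + snd (snd p)))"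
    and "(\<integral>p. f (fst p + snd (snd p)) \<partial>letter) = (\<integral>x. f x \<partial>gauss \<tau>)"
proof -
  have "(\<lambda>p :: real \<times> real \<times> real. fst p + snd (snd p)) \<in> borel_measurable (borel \<Otimes>\<^sub>M (borel \<Otimes>\<^sub>M borel))" by measurable
  note letter_transfer[OF distr_letter_output this assms]
  then show "integrable (gauss \<tau>) f \<Longrightarrow> integrable letter (\<lambda>p. f (fst p + snd (snd p)))"
    and "(\<integral>p. f (fst p + snd (snd p)) \<partial>letter) = (\<integral>x. f x \<partial>gauss \<tau>)" by blast+
qed

lemma dev_measurable [measurable]:
  "energy_dev silent \<in> borel_measurable letter" "info_dev silent \<in> borel_measurable letter"
  "channel_out silent \<in> borel_measurable letter"
proof -
  show "energy_dev silent \<in> borel_measurable letter"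
    unfolding energy_dev_def[abs_def] by (rule measurable_letter) measurable
  show "info_dev silent \<in> borel_measurable letter"
    unfolding info_dev_def[abs_def] by (rule measurable_letter) measurable
  show "channel_out silent \<in> borel_measurable letter"
    unfolding channel_out_def[abs_def] by (rule measurable_letter) measurable
qed

lemma integrable_D: "integrable D (\<lambda>y. y)"
proof -
  interpret prob_space D by (rule prob_D)
  have "(\<lambda>y. y) \<in> borel_measurable D" by (simp cong: measurable_cong_sets add: sets_D)
  then show ?thesis using square_integrable_D by (rule square_integrable_imp_integrable)
qed

lemma energy_dev_mean: "(\<integral>p. energy_dev silent p \<partial>letter) = 0"
proof -
  interpret prob_space letter by (rule prob_letter)
  have y: "integrable letter (\<lambda>p. fst (snd p))" "(\<integral>p. fst (snd p) \<partial>letter) = \<nu>\<^sup>2"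
    using letter_energy(1)[of "\<lambda>y. y", OF _ integrable_D] letter_energy(2)[of "\<lambda>y. y"] mean_D
    by simp_all
  have x: "integrable letter (\<lambda>p. (fst p)\<^sup>2)" "(\<integral>p. (fst p)\<^sup>2 \<partial>letter) = \<nu>\<^sup>2"
    using letter_input(1)[of "\<lambda>x. x\<^sup>2", OF _ integrable_gauss_power[OF \<nu>_pos, of 2]]
      letter_input(2)[of "\<lambda>x. x\<^sup>2"] integral_gauss_square[OF \<nu>_pos] by simp_all
  show ?thesis
  proof (cases silent)
    case True
    then show ?thesis using y prob_space by (simp add: energy_dev_def)
  next
    case False
    then show ?thesis using x y by (simp add: energy_dev_def)
  qed
qed

lemma info_dev_mean: "(\<integral>p. info_dev silent p \<partial>letter) = 0"
proof -
  have w: "integrable letter (\<lambda>p. (fst p + snd (snd p))\<^sup>2)" "(\<integral>p. (fst p + snd (snd p))\<^sup>2 \<partial>letter) = \<tau>\<^sup>2"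
    using letter_output(1)[of "\<lambda>x. x\<^sup>2", OF _ integrable_gauss_power[OF \<tau>_pos, of 2]]
      letter_output(2)[of "\<lambda>x. x\<^sup>2"] integral_gauss_square[OF \<tau>_pos] by simp_all
  have z: "integrable letter (\<lambda>p. (snd (snd p))\<^sup>2)" "(\<integral>p. (snd (snd p))\<^sup>2 \<partial>letter) = \<sigma>\<^sup>2"
    using letter_noise(1)[of "\<lambda>x. x\<^sup>2", OF _ integrable_gauss_power[OF \<sigma>_pos, of 2]]
      letter_noise(2)[of "\<lambda>x. x\<^sup>2"] integral_gauss_square[OF \<sigma>_pos] by simp_all
  show ?thesis
    using w z \<sigma>_pos \<tau>_pos by (cases silent) (simp_all add: info_dev_def)
qed

text \<open>The second moment of the harvest enters here. The energy spent is itself a square, so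
  its variance comes from the fourth Gaussian moment.\<close>

lemma energy_dev_square: "integrable letter (\<lambda>p. (energy_dev silent p)\<^sup>2)"
proof -
  interpret prob_space letter by (rule prob_letter)
  have [measurable]: "fst \<in> borel_measurable letter" "(\<lambda>p. fst (snd p)) \<in> borel_measurable letter"
    by (intro measurable_letter; measurable)+
  have y: "integrable letter (\<lambda>p. (fst (snd p))\<^sup>2)"
    using letter_energy(1)[of "\<lambda>y. y\<^sup>2", OF _ square_integrable_D] by simp
  have x: "integrable letter (\<lambda>p. ((fst p)\<^sup>2)\<^sup>2)"
    using letter_input(1)[of "\<lambda>x. x ^ 4", OF _ integrable_gauss_power[OF \<nu>_pos]]
    by (simp flip: power_mult)
  have "integrable letter (\<lambda>p. (if silent then \<nu>\<^sup>2 else (fst p)\<^sup>2)\<^sup>2)"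
    using x by (cases silent) simp_all
  with y show ?thesis
    unfolding energy_dev_def by (intro integrable_square_diff) measurable
qed

lemma info_dev_square: "integrable letter (\<lambda>p. (info_dev silent p)\<^sup>2)"
proof (cases silent)
  case False
  have [measurable]: "fst \<in> borel_measurable letter" "(\<lambda>p. snd (snd p)) \<in> borel_measurable letter"
    by (intro measurable_letter; measurable)+
  have "integrable letter (\<lambda>p. ((fst p + snd (snd p))\<^sup>2)\<^sup>2)"
    using letter_output(1)[of "\<lambda>x. x ^ 4", OF _ integrable_gauss_power[OF \<tau>_pos]]
    by (simp flip: power_mult)
  then have w: "integrable letter (\<lambda>p. ((fst p + snd (snd p))\<^sup>2 / (2 * \<tau>\<^sup>2))\<^sup>2)"
    unfolding power_divide by simp
  have "integrable letter (\<lambda>p. ((snd (snd p))\<^sup>2)\<^sup>2)"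
    using letter_noise(1)[of "\<lambda>x. x ^ 4", OF _ integrable_gauss_power[OF \<sigma>_pos]]
    by (simp flip: power_mult)
  then have z: "integrable letter (\<lambda>p. ((snd (snd p))\<^sup>2 / (2 * \<sigma>\<^sup>2))\<^sup>2)"
    unfolding power_divide by simp
  have "integrable letter (\<lambda>p. ((fst p + snd (snd p))\<^sup>2 / (2 * \<tau>\<^sup>2) - (snd (snd p))\<^sup>2 / (2 * \<sigma>\<^sup>2))\<^sup>2)"
    by (rule integrable_square_diff[OF _ _ w z]) measurable
  with False show ?thesis by (simp add: info_dev_def)
qed (simp add: info_dev_def)

end

section \<open>Achievability\<close>

definition delayed :: "nat \<Rightarrow> (nat \<Rightarrow> real) \<Rightarrow> nat \<Rightarrow> real" where
  "delayed s x i = (if i \<le> s then 0 else x i)"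

text \<open>The test charges the whole unguarded prefix rather than the energy really spent. This is
  conservative, but it avoids a recursion through earlier outages and depends on the energies only
  through a causal partial sum.\<close>

definition guarded_input :: "(nat \<Rightarrow> real) \<Rightarrow> (nat \<Rightarrow> real) \<Rightarrow> nat \<Rightarrow> real" where
  "guarded_input x y i = (if (\<Sum>j\<in>{1..i}. (x j)\<^sup>2) \<le> (\<Sum>j\<in>{1..i}. y j) then x i else 0)"

text \<open>A passed test bounds the energy of the entire prefix at once; a failed test adds no
  expense, so the previous bound persists.\<close>

lemma sum_guarded_input_le:
  assumes y: "\<And>j. 0 \<le> y j"
  shows "(\<Sum>j\<in>{1..i}. (guarded_input x y j)\<^sup>2) \<le> (\<Sum>j\<in>{1..i}. y j)"
proof (induction i)
  case (Suc i)
  show ?case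
  proof (cases "(\<Sum>j\<in>{1..Suc i}. (x j)\<^sup>2) \<le> (\<Sum>j\<in>{1..Suc i}. y j)")
    case True
    have "(\<Sum>j\<in>{1..Suc i}. (guarded_input x y j)\<^sup>2) \<le> (\<Sum>j\<in>{1..Suc i}. (x j)\<^sup>2)"
      by (intro sum_mono) (simp add: guarded_input_def)
    then show ?thesis using True by simp
  next
    case False
    then have "guarded_input x y (Suc i) = 0" by (simp add: guarded_input_def)
    then show ?thesis using Suc y[of "Suc i"] by simp
  qed
qed simp

lemma channel_input_guarded:
  "channel_input (\<lambda>m i y. guarded_input (c m) y i) m y = guarded_input (c m) y"
proof (rule ext)
  fix i
  have "(\<Sum>j\<in>{1..i}. restrict y {1..i} j) = (\<Sum>j\<in>{1..i}. y j)" by (rule sum.cong) auto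
  then show "channel_input (\<lambda>m i y. guarded_input (c m) y i) m y i = guarded_input (c m) y i"
    by (simp add: channel_input_def guarded_input_def)
qed

lemma eh_code_guarded:
  assumes "1 \<le> M" and "dec \<in> measurable (\<Pi>\<^sub>M j\<in>{1..n}. borel) (count_space {1..M})"
  shows "eh_code n M (\<lambda>m i y. guarded_input (c m) y i) dec"
  unfolding eh_code_def channel_input_guarded
proof (intro conjI assms ballI allI impI)
  fix m i assume "i \<in> {1..n}"
  show "(\<lambda>y. guarded_input (c m) y i) \<in> borel_measurable (\<Pi>\<^sub>M j\<in>{1..i}. borel)"
    unfolding guarded_input_def by measurable
next
  fix m i and y :: "nat \<Rightarrow> real" assume i: "i \<in> {1..n}" and y: "\<forall>j. 0 \<le> y j"
  obtain k where k: "i = Suc k" using i by (cases i) auto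
  show "(guarded_input (c m) y i)\<^sup>2 \<le> buffer y (guarded_input (c m) y) i + y i"
    using sum_guarded_input_le[of y "c m" "Suc k"] y by (simp add: k buffer_Suc sum_subtractf)
qed

lemma sum_delayed_square:
  assumes "s \<le> k"
  shows "(\<Sum>i\<in>{1..k}. if i \<le> s then (b::real) else (x i)\<^sup>2) = real s * b + (\<Sum>i\<in>{1..k}. (delayed s x i)\<^sup>2)"
proof -
  have "(\<Sum>i\<in>{1..k}. if i \<le> s then b else (x i)\<^sup>2)
      = (\<Sum>i\<in>{1..k}. (if i \<in> {1..s} then b else 0) + (delayed s x i)\<^sup>2)"
    by (intro sum.cong) (auto simp: delayed_def)
  also have "\<dots> = (\<Sum>i\<in>{1..s}. b) + (\<Sum>i\<in>{1..k}. (delayed s x i)\<^sup>2)"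
  proof -
    have "(\<Sum>i\<in>{1..k}. if i \<in> {1..s} then b else 0) = (\<Sum>i\<in>{1..k} \<inter> {1..s}. b)"
      by (simp only: sum.inter_restrict finite_atLeastAtMost)
    also have "{1..k} \<inter> {1..s} = {1..s}" using assms by auto
    finally show ?thesis by (simp only: sum.distrib)
  qed
  finally show ?thesis by simp
qed

section \<open>Random coding at a fixed blocklength\<close>

context gaussian_input
begin

text \<open>The sum of both phase variances serves as a bound for either phase. No such sum is taken
  for \<open>info_var\<close>, because the silent deviation is identically 0.\<close>

definition energy_var :: real where
  "energy_var = (\<integral>p. (energy_dev True p)\<^sup>2 \<partial>letter) + (\<integral>p. (energy_dev False p)\<^sup>2 \<partial>letter)"

definition info_var :: real where
  "info_var = (\<integral>p. (info_dev False p)\<^sup>2 \<partial>letter)"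

definition capacity :: real where "capacity = ln (\<tau> / \<sigma>)"

lemma sum_var_le:
  "(\<Sum>i\<in>{1..n}. \<integral>p. (energy_dev (i \<le> s) p)\<^sup>2 \<partial>letter) \<le> real n * energy_var"
  "(\<Sum>i\<in>{1..n}. \<integral>p. (info_dev (i \<le> s) p)\<^sup>2 \<partial>letter) \<le> real n * info_var"
proof -
  have "(\<integral>p. (energy_dev b p)\<^sup>2 \<partial>letter) \<le> energy_var" for b
    by (cases b) (simp_all add: energy_var_def)
  then have "(\<Sum>i\<in>{1..n}. \<integral>p. (energy_dev (i \<le> s) p)\<^sup>2 \<partial>letter) \<le> (\<Sum>i\<in>{1..n}. energy_var)"
    by (intro sum_mono)
  then show "(\<Sum>i\<in>{1..n}. \<integral>p. (energy_dev (i \<le> s) p)\<^sup>2 \<partial>letter) \<le> real n * energy_var" by simp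
  have "(\<integral>p. (info_dev b p)\<^sup>2 \<partial>letter) \<le> info_var" for b
    by (cases b) (simp_all add: info_var_def info_dev_def[of True])
  then have "(\<Sum>i\<in>{1..n}. \<integral>p. (info_dev (i \<le> s) p)\<^sup>2 \<partial>letter) \<le> (\<Sum>i\<in>{1..n}. info_var)"
    by (intro sum_mono)
  then show "(\<Sum>i\<in>{1..n}. \<integral>p. (info_dev (i \<le> s) p)\<^sup>2 \<partial>letter) \<le> real n * info_var" by simp
qed

text \<open>From time \<open>s\<close> on, the deviation sum equals harvest minus codeword energy
  minus the reserve \<open>real s * \<nu>\<^sup>2\<close>. As long as it stays above minus the
  reserve, the codeword is affordable.\<close>

lemma delayed_admissible:
  assumes s: "s \<le> k" and k: "k \<le> n"
    and dev: "\<And>k. k \<le> n \<Longrightarrow> \<bar>\<Sum>i\<in>{1..k}. energy_dev (i \<le> s) (x i, y i, z i)\<bar> < real s * \<nu>\<^sup>2"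
  shows "(\<Sum>i\<in>{1..k}. (delayed s x i)\<^sup>2) \<le> (\<Sum>i\<in>{1..k}. y i)"
proof -
  have "(\<Sum>i\<in>{1..k}. energy_dev (i \<le> s) (x i, y i, z i))
      = (\<Sum>i\<in>{1..k}. y i) - (\<Sum>i\<in>{1..k}. if i \<le> s then \<nu>\<^sup>2 else (x i)\<^sup>2)"
    unfolding sum_subtractf[symmetric] by (intro sum.cong) (auto simp: energy_dev_def)
  then show ?thesis using dev[OF k] unfolding sum_delayed_square[OF s] by linarith
qed

lemma information_density_eq:
  "(\<Sum>i\<in>{s<..n}. capacity + (x i + z i)\<^sup>2 / (2 * \<tau>\<^sup>2) - (z i)\<^sup>2 / (2 * \<sigma>\<^sup>2))
    = real (n - s) * capacity + (\<Sum>i\<in>{1..n}. info_dev (i \<le> s) (x i, y i, z i))"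
proof -
  have "(\<Sum>i\<in>{1..n}. info_dev (i \<le> s) (x i, y i, z i))
      = (\<Sum>i\<in>{s<..n}. (x i + z i)\<^sup>2 / (2 * \<tau>\<^sup>2) - (z i)\<^sup>2 / (2 * \<sigma>\<^sup>2))"
    by (rule sum.mono_neutral_cong_right) (auto simp: info_dev_def)
  then show ?thesis by (simp add: sum.distrib sum_subtractf)
qed

text \<open>The three summands bound the probabilities of an energy shortage, of an information
  density lower than its mean by \<open>t\<close> or more, and of an output already claimed by one
  of the other \<open>M - 1\<close> codewords.\<close>

lemma code_exists:
  assumes "0 < s" and "0 < t" and "1 \<le> M"
    and M: "real n * energy_var / (real s * \<nu>\<^sup>2)\<^sup>2 + real n * info_var / t\<^sup>2
        + (real M - 1) * exp (- (real (n - s) * capacity - t)) < \<epsilon>"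
  shows "\<exists>enc dec. eh_code n M enc dec \<and> eh_error_prob D \<sigma> n M enc dec \<le> \<epsilon>"
proof -
  define \<gamma> where "\<gamma> = real (n - s) * capacity - t"
  define \<delta> where "\<delta> = real n * energy_var / (real s * \<nu>\<^sup>2)\<^sup>2 + real n * info_var / t\<^sup>2"
  let ?I = "{1..n}" and ?J = "{s<..n}"
  let ?X = "\<Pi>\<^sub>M i\<in>?I. gauss \<nu>" and ?Y = "\<Pi>\<^sub>M i\<in>?I. D" and ?Z = "\<Pi>\<^sub>M i\<in>?I. gauss \<sigma>"
  let ?T = "?Y \<Otimes>\<^sub>M ?Z" and ?W = "\<Pi>\<^sub>M i\<in>?I. gauss (if i \<in> ?J then \<tau> else \<sigma>)"
  let ?R = "\<Pi>\<^sub>M i\<in>?I. letter"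
  \<comment> \<open>\<open>h\<close> is the true channel with outages; its randomness
    \<open>q\<close> consists of energies and noise.\<close>
  define h where "h x q = (\<lambda>i\<in>?I. guarded_input (delayed s x) (fst q) i + snd q i)"
    for x and q :: "(nat \<Rightarrow> real) \<times> (nat \<Rightarrow> real)"
  \<comment> \<open>The test belongs to the outage-free channel. Silent times are omitted: there
    both the channel and the reference law \<open>?W\<close> give pure noise, so their likelihood
    ratio is 1.\<close>
  define dens where "dens x w \<longleftrightarrow>
      \<gamma> < (\<Sum>i\<in>?J. capacity + (w i)\<^sup>2 / (2 * \<tau>\<^sup>2) - (w i - x i)\<^sup>2 / (2 * \<sigma>\<^sup>2))" for x w :: "nat \<Rightarrow> real"
  have pX: "prob_space ?X" by (intro prob_space_PiM prob_space_gauss \<nu>_pos)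
  have pT: "prob_space ?T" by (intro prob_space_pair prob_space_PiM prob_space_gauss prob_D \<sigma>_pos)
  have pW: "prob_space ?W" by (intro prob_space_PiM prob_space_gauss) (simp add: \<sigma>_pos \<tau>_pos)
  interpret R: prob_space ?R by (intro prob_space_PiM prob_letter)
  interpret XT: prob_space "?X \<Otimes>\<^sub>M ?T" by (intro prob_space_pair pX pT)
  have sX: "sets ?X = sets (\<Pi>\<^sub>M i\<in>?I. borel)" and sY: "sets ?Y = sets (\<Pi>\<^sub>M i\<in>?I. borel)"
    and sZ: "sets ?Z = sets (\<Pi>\<^sub>M i\<in>?I. borel)" and sW: "sets ?W = sets (\<Pi>\<^sub>M i\<in>?I. borel)"
    by (intro sets_PiM_cong; simp add: sets_D)+
  have h_meas: "(\<lambda>(x, q). h x q) \<in> measurable (?X \<Otimes>\<^sub>M ?T) ?W"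
  proof -
    let ?B = "\<Pi>\<^sub>M i\<in>?I. borel :: real measure"
    have comp: "(\<lambda>p. fst p j) \<in> borel_measurable (?B \<Otimes>\<^sub>M (?B \<Otimes>\<^sub>M ?B))"
      "(\<lambda>p. fst (snd p) j) \<in> borel_measurable (?B \<Otimes>\<^sub>M (?B \<Otimes>\<^sub>M ?B))"
      "(\<lambda>p. snd (snd p) j) \<in> borel_measurable (?B \<Otimes>\<^sub>M (?B \<Otimes>\<^sub>M ?B))" if j: "j \<in> ?I" for j
    proof -
      note ev = measurable_component_singleton[OF j, of "\<lambda>_. borel :: real measure"]
      show "(\<lambda>p. fst p j) \<in> borel_measurable (?B \<Otimes>\<^sub>M (?B \<Otimes>\<^sub>M ?B))"
        by (rule measurable_compose[OF measurable_fst ev])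
      show "(\<lambda>p. fst (snd p) j) \<in> borel_measurable (?B \<Otimes>\<^sub>M (?B \<Otimes>\<^sub>M ?B))"
        by (rule measurable_compose[OF measurable_compose[OF measurable_snd measurable_fst] ev])
      show "(\<lambda>p. snd (snd p) j) \<in> borel_measurable (?B \<Otimes>\<^sub>M (?B \<Otimes>\<^sub>M ?B))"
        by (rule measurable_compose[OF measurable_compose[OF measurable_snd measurable_snd] ev])
    qed
    have dly: "(\<lambda>p. delayed s (fst p) j) \<in> borel_measurable (?B \<Otimes>\<^sub>M (?B \<Otimes>\<^sub>M ?B))" if "j \<in> ?I" for j
      using comp(1)[OF that] by (cases "j \<le> s") (simp_all add: delayed_def)
    have "(\<lambda>p. h (fst p) (snd p)) \<in> measurable (?B \<Otimes>\<^sub>M (?B \<Otimes>\<^sub>M ?B)) ?B"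
      unfolding h_def guarded_input_def
      by (intro measurable_restrict borel_measurable_add measurable_If borel_measurable_le
          borel_measurable_sum borel_measurable_power borel_measurable_const dly comp) auto
    moreover have "measurable (?X \<Otimes>\<^sub>M ?T) ?W
        = measurable ((\<Pi>\<^sub>M i\<in>?I. borel) \<Otimes>\<^sub>M ((\<Pi>\<^sub>M i\<in>?I. borel) \<Otimes>\<^sub>M (\<Pi>\<^sub>M i\<in>?I. borel))) (\<Pi>\<^sub>M i\<in>?I. borel)"
      by (intro measurable_cong_sets sets_pair_measure_cong sX sY sZ sW)
    ultimately show ?thesis by (simp add: split_beta')
  qed
  have dens_meas: "Measurable.pred (?X \<Otimes>\<^sub>M ?W) (\<lambda>(x, w). dens x w)"
  proof -
    have [measurable]: "(\<lambda>x. x i) \<in> borel_measurable (\<Pi>\<^sub>M i\<in>?I. borel :: real measure)" if "i \<in> ?J" for i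
      using that by (intro measurable_component_singleton) auto
    have "Measurable.pred ((\<Pi>\<^sub>M i\<in>?I. borel) \<Otimes>\<^sub>M (\<Pi>\<^sub>M i\<in>?I. borel)) (\<lambda>p. dens (fst p) (snd p))"
      unfolding dens_def by measurable
    moreover have "measurable (?X \<Otimes>\<^sub>M ?W) (count_space UNIV)
        = measurable ((\<Pi>\<^sub>M i\<in>?I. borel) \<Otimes>\<^sub>M (\<Pi>\<^sub>M i\<in>?I. borel)) (count_space (UNIV :: bool set))"
      by (intro measurable_cong_sets sets_pair_measure_cong sX sW refl)
    ultimately show ?thesis by (simp add: split_beta')
  qed
  have dens_le: "measure ?W {w \<in> space ?W. dens x w} \<le> exp (- \<gamma>)" for x
    unfolding dens_def capacity_def
    by (rule measure_information_density_le) (auto simp: \<sigma>_pos \<tau>_pos)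
  have good: "1 - \<delta> - measure ?W U
      \<le> measure (?X \<Otimes>\<^sub>M ?T) {(x, q) \<in> space (?X \<Otimes>\<^sub>M ?T). dens x (h x q) \<and> h x q \<notin> U}"
    if U: "U \<in> sets ?W" for U
  proof -
    \<comment> \<open>\<open>B1\<close> is energy shortage, \<open>B2\<close> atypical information
      density, \<open>B3\<close> an outage-free output in \<open>U\<close>. Outside all three the
      true output is the outage-free one, passes the test and avoids \<open>U\<close>. Defining
      \<open>B3\<close> by the outage-free output gives it exactly the probability of
      \<open>U\<close> under \<open>?W\<close>.\<close>
    define B1 where "B1 = {p \<in> space ?R. \<exists>k\<le>n. real s * \<nu>\<^sup>2 \<le> \<bar>\<Sum>i\<in>{1..k}. energy_dev (i \<le> s) (p i)\<bar>}"
    define B2 where "B2 = {p \<in> space ?R. \<exists>k\<le>n. t \<le> \<bar>\<Sum>i\<in>{1..k}. info_dev (i \<le> s) (p i)\<bar>}"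
    define out where "out p = (\<lambda>i\<in>?I. channel_out (i \<le> s) (p i))" for p :: "nat \<Rightarrow> real \<times> real \<times> real"
    define B3 where "B3 = out -` U \<inter> space ?R"
    define zip where "zip = (\<lambda>(x, y, z). \<lambda>i\<in>?I. (x i, y i, z i) :: real \<times> real \<times> real)"
    have out: "distr ?R (\<Pi>\<^sub>M i\<in>?I. borel) out = ?W"
    proof -
      have "distr ?R (\<Pi>\<^sub>M i\<in>?I. borel) out = (\<Pi>\<^sub>M i\<in>?I. distr letter borel (channel_out (i \<le> s)))"
        unfolding out_def by (rule distr_PiM_componentwise) (auto intro: prob_letter)
      also have "\<dots> = ?W"
        by (rule PiM_cong) (auto simp: distr_letter_channel_out)
      finally show ?thesis .
    qed
    have out_meas: "out \<in> measurable ?R (\<Pi>\<^sub>M i\<in>?I. borel)"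
      unfolding out_def by measurable
    have U': "U \<in> sets (\<Pi>\<^sub>M i\<in>?I. borel)" using U sW by blast
    have B3: "B3 \<in> sets ?R" "measure ?R B3 = measure ?W U"
      unfolding B3_def out[symmetric]
      by (rule measurable_sets[OF out_meas U'], rule measure_distr[OF out_meas U', symmetric])
    have Bk: "{p \<in> space ?R. \<exists>k\<le>n. L \<le> \<bar>\<Sum>i\<in>{1..k}. u (i \<le> s) (p i)\<bar>} \<in> sets ?R"
      if [measurable]: "\<And>b. u b \<in> borel_measurable letter" for u :: "bool \<Rightarrow> _ \<Rightarrow> real" and L :: real
    proof -
      have "{p \<in> space ?R. L \<le> \<bar>\<Sum>i\<in>{1..k}. u (i \<le> s) (p i)\<bar>} \<in> sets ?R" if "k \<le> n" for k
      proof -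
        have [measurable]: "(\<lambda>p. p i) \<in> measurable ?R letter" if "i \<in> {1..k}" for i
          using that \<open>k \<le> n\<close> by (intro measurable_component_singleton) auto
        show ?thesis by measurable
      qed
      then have "(\<Union>k\<in>{..n}. {p \<in> space ?R. L \<le> \<bar>\<Sum>i\<in>{1..k}. u (i \<le> s) (p i)\<bar>}) \<in> sets ?R"
        by (intro sets.finite_UN) auto
      also have "(\<Union>k\<in>{..n}. {p \<in> space ?R. L \<le> \<bar>\<Sum>i\<in>{1..k}. u (i \<le> s) (p i)\<bar>})
          = {p \<in> space ?R. \<exists>k\<le>n. L \<le> \<bar>\<Sum>i\<in>{1..k}. u (i \<le> s) (p i)\<bar>}" by auto
      finally show ?thesis .
    qed
    have B1: "B1 \<in> sets ?R" and B2: "B2 \<in> sets ?R"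
      unfolding B1_def B2_def by (intro Bk dev_measurable)+
    have s\<nu>: "0 < real s * \<nu>\<^sup>2" using \<open>0 < s\<close> \<nu>_pos by simp
    have "measure ?R B1 \<le> (\<Sum>i\<in>{1..n}. \<integral>p. (energy_dev (i \<le> s) p)\<^sup>2 \<partial>letter) / (real s * \<nu>\<^sup>2)\<^sup>2"
      unfolding B1_def
      by (rule kolmogorov_maximal_inequality)
        (auto intro: prob_letter energy_dev_square energy_dev_mean dev_measurable s\<nu>)
    also have "\<dots> \<le> real n * energy_var / (real s * \<nu>\<^sup>2)\<^sup>2"
      by (intro divide_right_mono sum_var_le) simp
    finally have m1: "measure ?R B1 \<le> real n * energy_var / (real s * \<nu>\<^sup>2)\<^sup>2" .
    have "measure ?R B2 \<le> (\<Sum>i\<in>{1..n}. \<integral>p. (info_dev (i \<le> s) p)\<^sup>2 \<partial>letter) / t\<^sup>2"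
      unfolding B2_def
      by (rule kolmogorov_maximal_inequality)
        (auto intro: prob_letter info_dev_square info_dev_mean dev_measurable \<open>0 < t\<close>)
    also have "\<dots> \<le> real n * info_var / t\<^sup>2"
      by (intro divide_right_mono sum_var_le) simp
    finally have m2: "measure ?R B2 \<le> real n * info_var / t\<^sup>2" .
    have "measure ?R (B1 \<union> B2 \<union> B3) \<le> measure ?R (B1 \<union> B2) + measure ?R B3"
      by (intro measure_Un_le sets.Un B1 B2 B3)
    also have "measure ?R (B1 \<union> B2) \<le> measure ?R B1 + measure ?R B2"
      by (intro measure_Un_le B1 B2)
    finally have "1 - \<delta> - measure ?W U \<le> 1 - measure ?R (B1 \<union> B2 \<union> B3)"
      using m1 m2 B3(2) by (simp add: \<delta>_def)
    also have "\<dots> = measure ?R (space ?R - (B1 \<union> B2 \<union> B3))"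
      by (rule R.prob_compl[symmetric]) (intro sets.Un B1 B2 B3)
    also have "?R = distr (?X \<Otimes>\<^sub>M ?T) ?R zip"
      unfolding zip_def letter_def by (rule triple_PiM[symmetric]) (auto intro: prob_space_gauss prob_D \<nu>_pos \<sigma>_pos)
    also have "measure (distr (?X \<Otimes>\<^sub>M ?T) ?R zip) (space (distr (?X \<Otimes>\<^sub>M ?T) ?R zip) - (B1 \<union> B2 \<union> B3))
        = measure (?X \<Otimes>\<^sub>M ?T) (zip -` (space ?R - (B1 \<union> B2 \<union> B3)) \<inter> space (?X \<Otimes>\<^sub>M ?T))"
    proof (subst measure_distr)
      show "zip \<in> measurable (?X \<Otimes>\<^sub>M ?T) ?R"
        unfolding zip_def letter_def
        by (intro measurable_split_conv[THEN iffD2] measurable_restrict) measurable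
    qed (use B1 B2 B3 in auto)
    also have "\<dots> \<le> measure (?X \<Otimes>\<^sub>M ?T) {(x, q) \<in> space (?X \<Otimes>\<^sub>M ?T). dens x (h x q) \<and> h x q \<notin> U}"
    proof (rule XT.finite_measure_mono)
      show "zip -` (space ?R - (B1 \<union> B2 \<union> B3)) \<inter> space (?X \<Otimes>\<^sub>M ?T)
          \<subseteq> {(x, q) \<in> space (?X \<Otimes>\<^sub>M ?T). dens x (h x q) \<and> h x q \<notin> U}"
      proof (rule subsetI)
        fix q assume q: "q \<in> zip -` (space ?R - (B1 \<union> B2 \<union> B3)) \<inter> space (?X \<Otimes>\<^sub>M ?T)"
        obtain x y z where xyz: "q = (x, y, z)" by (cases q) auto
        have zsp: "zip (x, y, z) \<in> space ?R" and nB: "zip (x, y, z) \<notin> B1 \<union> B2 \<union> B3"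
          using q unfolding xyz by blast+
        have z_sum: "(\<Sum>i\<in>{1..k}. u (i \<le> s) (zip (x, y, z) i)) = (\<Sum>i\<in>{1..k}. u (i \<le> s) (x i, y i, z i))"
          if "k \<le> n" for k and u :: "bool \<Rightarrow> _ \<Rightarrow> real"
          by (intro sum.cong) (use that in \<open>auto simp: zip_def\<close>)
        have e: "\<bar>\<Sum>i\<in>{1..k}. energy_dev (i \<le> s) (x i, y i, z i)\<bar> < real s * \<nu>\<^sup>2" if "k \<le> n" for k
          using nB zsp that z_sum[OF that, of energy_dev] by (force simp: B1_def)
        have i: "\<bar>\<Sum>i\<in>{1..n}. info_dev (i \<le> s) (x i, y i, z i)\<bar> < t"
          using nB zsp z_sum[OF order_refl, of info_dev] by (force simp: B2_def)
        \<comment> \<open>For \<open>i \<le> s\<close> the symbol is 0 whether or not the guard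
          fires, so affordability matters only after the saving phase.\<close>
        have h: "h x (y, z) i = delayed s x i + z i" if "i \<in> ?I" for i
        proof (cases "i \<le> s")
          case True
          then show ?thesis using that by (simp add: h_def guarded_input_def delayed_def)
        next
          case False
          then show ?thesis
            using that delayed_admissible[of s i n x y z] e by (simp add: h_def guarded_input_def)
        qed
        have "h x (y, z) = out (zip (x, y, z))"
        proof (rule ext)
          fix i
          show "h x (y, z) i = out (zip (x, y, z)) i"
          proof (cases "i \<in> ?I")
            case True
            then show ?thesis
              unfolding h[OF True] by (simp add: out_def zip_def channel_out_def delayed_def)
          next
            case False
            then show ?thesis by (simp only: h_def out_def restrict_apply if_False)
          qed
        qed
        then have "h x (y, z) \<notin> U" using nB zsp by (simp add: B3_def)
        moreover have "dens x (h x (y, z))"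
        proof -
          have "(\<Sum>i\<in>?J. capacity + (h x (y, z) i)\<^sup>2 / (2 * \<tau>\<^sup>2) - (h x (y, z) i - x i)\<^sup>2 / (2 * \<sigma>\<^sup>2))
              = (\<Sum>i\<in>?J. capacity + (x i + z i)\<^sup>2 / (2 * \<tau>\<^sup>2) - (z i)\<^sup>2 / (2 * \<sigma>\<^sup>2))"
            by (intro sum.cong) (auto simp: h delayed_def)
          then show ?thesis
            using i unfolding dens_def \<gamma>_def information_density_eq[of x z s n y] by simp
        qed
        ultimately show "q \<in> {(x, q) \<in> space (?X \<Otimes>\<^sub>M ?T). dens x (h x q) \<and> h x q \<notin> U}"
          using q unfolding xyz by blast
      qed
      show "{(x, q) \<in> space (?X \<Otimes>\<^sub>M ?T). dens x (h x q) \<and> h x q \<notin> U} \<in> XT.events"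
      proof -
        have [measurable]: "(\<lambda>p. h (fst p) (snd p)) \<in> measurable (?X \<Otimes>\<^sub>M ?T) ?W"
          using h_meas by (simp add: split_beta')
        have "(\<lambda>p. (fst p, h (fst p) (snd p))) \<in> measurable (?X \<Otimes>\<^sub>M ?T) (?X \<Otimes>\<^sub>M ?W)" by measurable
        from measurable_compose[OF this dens_meas]
        have [measurable]: "Measurable.pred (?X \<Otimes>\<^sub>M ?T) (\<lambda>p. dens (fst p) (h (fst p) (snd p)))" by simp
        note U [measurable]
        have "{p \<in> space (?X \<Otimes>\<^sub>M ?T). dens (fst p) (h (fst p) (snd p)) \<and> h (fst p) (snd p) \<notin> U} \<in> XT.events"
          by measurable
        then show ?thesis by (simp add: split_beta')
      qed
    qed
    finally show ?thesis .
  qed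
  obtain c dec0 where c: "\<And>m. m \<in> {1..M} \<Longrightarrow> c m \<in> space ?X"
    and dec0 [measurable]: "dec0 \<in> measurable ?W (count_space UNIV)"
    and dec0_le: "\<And>w. w \<in> space ?W \<Longrightarrow> dec0 w \<le> M"
    and err: "\<And>m. m \<in> {1..M} \<Longrightarrow> 1 - \<epsilon> \<le> measure ?T {q \<in> space ?T. dec0 (h (c m) q) = m}"
    using feinstein[OF pX pT pW h_meas dens_meas dens_le _ good, of M \<epsilon>] M
    unfolding \<gamma>_def[symmetric] \<delta>_def[symmetric] by fastforce
  \<comment> \<open>An \<open>eh_code\<close> decoder must name a message. Sending the value 0 for
    undecoded outputs to message 1 can only enlarge the success events.\<close>
  define dec where "dec w = max 1 (dec0 w)" for w
  have "dec \<in> measurable ?W (count_space {1..M})"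
  proof (subst measurable_count_space_eq2)
    show "dec \<in> space ?W \<rightarrow> {1..M} \<and> (\<forall>a\<in>{1..M}. dec -` {a} \<inter> space ?W \<in> sets ?W)"
    proof (intro conjI ballI)
      show "dec \<in> space ?W \<rightarrow> {1..M}" using dec0_le \<open>1 \<le> M\<close> by (auto simp: dec_def)
      have "dec \<in> measurable ?W (count_space UNIV)" unfolding dec_def[abs_def] by measurable
      then show "dec -` {a} \<inter> space ?W \<in> sets ?W" for a by (rule measurable_sets) simp
    qed
  qed simp
  then have dec: "dec \<in> measurable (\<Pi>\<^sub>M i\<in>?I. borel) (count_space {1..M})"
    using measurable_cong_sets[OF sW refl] by blast
  let ?enc = "\<lambda>m i y. guarded_input (delayed s (c m)) y i"
  have code: "eh_code n M ?enc dec" by (rule eh_code_guarded[OF \<open>1 \<le> M\<close> dec])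
  have "1 - \<epsilon> \<le> measure ?T (decoded_event D \<sigma> n ?enc dec m)" if m: "m \<in> {1..M}" for m
  proof -
    interpret T: prob_space ?T by (rule pT)
    have "received n ?enc m = h (c m)"
      by (intro ext) (simp add: received_def h_def channel_input_guarded[of "\<lambda>m. delayed s (c m)"])
    then have "{q \<in> space ?T. dec0 (h (c m) q) = m} \<subseteq> decoded_event D \<sigma> n ?enc dec m"
      using m by (auto simp: decoded_event_def dec_def)
    then have "measure ?T {q \<in> space ?T. dec0 (h (c m) q) = m} \<le> measure ?T (decoded_event D \<sigma> n ?enc dec m)"
      by (rule T.finite_measure_mono) (rule decoded_event_measurable[OF sets_D code m])
    then show ?thesis using err[OF m] by simp
  qed
  then have "(\<Sum>m\<in>{1..M}. 1 - \<epsilon>) \<le> (\<Sum>m\<in>{1..M}. measure ?T (decoded_event D \<sigma> n ?enc dec m))"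
    by (intro sum_mono)
  then have "real M * (1 - \<epsilon>) \<le> (\<Sum>m\<in>{1..M}. measure ?T (decoded_event D \<sigma> n ?enc dec m))" by simp
  then have "eh_error_prob D \<sigma> n M ?enc dec \<le> \<epsilon>"
    unfolding eh_error_prob_eq[OF prob_D sets_D \<sigma>_pos code] using \<open>1 \<le> M\<close>
    by (simp add: field_simps)
  with code show ?thesis by blast
qed

end

section \<open>Asymptotics in the blocklength\<close>

lemma filterlim_log_powr_at_top:
  assumes "0 < a"
  shows "filterlim (\<lambda>n. log 2 (real n) powr a) at_top sequentially"
proof -
  have "filterlim (\<lambda>n. ln (real n)) at_top sequentially"
    by (rule filterlim_compose[OF ln_at_top filterlim_real_sequentially])
  then have "filterlim (\<lambda>n. 1 / ln 2 * ln (real n)) at_top sequentially"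
    by (intro filterlim_tendsto_pos_mult_at_top[OF tendsto_const]) auto
  then have lg: "filterlim (\<lambda>n. log 2 (real n)) at_top sequentially"
    by (simp add: log_def)
  have "filterlim (\<lambda>n. ln (log 2 (real n))) at_top sequentially"
    by (rule filterlim_compose[OF ln_at_top lg])
  then have "filterlim (\<lambda>n. a * ln (log 2 (real n))) at_top sequentially"
    using assms by (intro filterlim_tendsto_pos_mult_at_top[OF tendsto_const]) auto
  then have lim: "filterlim (\<lambda>n. exp (a * ln (log 2 (real n)))) at_top sequentially"
    by (rule filterlim_compose[OF exp_at_top])
  have ev: "\<forall>\<^sub>F n in sequentially. exp (a * ln (log 2 (real n))) = log 2 (real n) powr a"
  proof -
    have "\<forall>\<^sub>F n in sequentially. 0 < log 2 (real n)"
      using lg by (simp add: filterlim_at_top_dense)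
    then show ?thesis by eventually_elim (simp add: powr_def)
  qed
  show ?thesis by (rule filterlim_cong[OF refl refl ev, THEN iffD1, OF lim])
qed

context gaussian_input
begin

lemma capacity_eq: "capacity / ln 2 = C_EG (\<nu>\<^sup>2) \<sigma>"
proof -
  have "(\<tau> / \<sigma>)\<^sup>2 = 1 + \<nu>\<^sup>2 / \<sigma>\<^sup>2" using \<sigma>_pos by (simp add: power_divide \<tau>_square field_simps)
  moreover have "ln ((\<tau> / \<sigma>)\<^sup>2) = 2 * capacity"
    using \<tau>_pos \<sigma>_pos by (simp add: ln_realpow capacity_def)
  ultimately show ?thesis by (simp add: C_EG_def log_def)
qed

lemma capacity_pos: "0 < capacity"
proof -
  have "\<sigma> < \<tau>" unfolding \<tau>_def using \<nu>_pos \<sigma>_pos by (intro real_less_rsqrt) simp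
  then show ?thesis using \<sigma>_pos by (simp add: capacity_def)
qed

text \<open>Silence and slack \<open>t\<close> each take a quarter of
  \<open>sqrt n * \<omega> * capacity\<close>, whence the factor 16 in \<open>large\<close>. Half of
  \<open>\<epsilon>\<close> pays for shortage and atypical density, the other half for confusion
  between codewords. The term \<open>- capacity\<close> comes from rounding \<open>s\<close>
  up.\<close>

lemma max_code_size_ge:
  assumes pos: "AE y in D. 0 \<le> y" and \<epsilon>: "0 < \<epsilon>" "\<epsilon> < 1"
    and n: "0 < n" and \<omega>: "0 < \<omega>"
    and large: "16 * (energy_var / \<nu> ^ 4 + info_var / capacity\<^sup>2) / \<omega>\<^sup>2 \<le> \<epsilon> / 2"
  shows "real n * capacity - sqrt n * \<omega> * capacity / 2 - capacity + ln (\<epsilon> / 2)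
    \<le> ln (real (eh_max_code_size D \<sigma> n \<epsilon>))"
proof -
  define s where "s = nat \<lceil>sqrt n * \<omega> / 4\<rceil>"
  define t where "t = sqrt n * \<omega> * capacity / 4"
  define \<gamma> where "\<gamma> = real (n - s) * capacity - t"
  \<comment> \<open>Rounding up ensures \<open>1 \<le> M\<close>, and \<open>real M - 1\<close>
    stays below the unrounded value, which is all that the confusion term in
    \<open>code_exists\<close> involves.\<close>
  define M where "M = nat \<lceil>\<epsilon> / 2 * exp \<gamma>\<rceil>"
  note cap = capacity_pos
  have q: "0 < sqrt n * \<omega> / 4" using n \<omega> by simp
  then have s: "sqrt n * \<omega> / 4 \<le> real s" "real s \<le> sqrt n * \<omega> / 4 + 1" "0 < s"
    unfolding s_def by linarith+
  have t: "0 < t" using n \<omega> cap by (simp add: t_def)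
  have e: "0 < \<epsilon> / 2 * exp \<gamma>" using \<epsilon> by simp
  then have M: "1 \<le> M" "\<epsilon> / 2 * exp \<gamma> \<le> real M" "real M - 1 < \<epsilon> / 2 * exp \<gamma>"
    unfolding M_def by linarith+
  have ev: "0 \<le> energy_var" "0 \<le> info_var" by (simp_all add: energy_var_def info_var_def)
  have "(sqrt n * \<omega> / 4 * \<nu>\<^sup>2)\<^sup>2 \<le> (real s * \<nu>\<^sup>2)\<^sup>2"
    using s q by (intro power_mono mult_right_mono) auto
  then have "real n * energy_var / (real s * \<nu>\<^sup>2)\<^sup>2 \<le> real n * energy_var / (sqrt n * \<omega> / 4 * \<nu>\<^sup>2)\<^sup>2"
    using ev q \<nu>_pos s by (intro divide_left_mono mult_pos_pos zero_less_power mult_nonneg_nonneg) auto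
  also have "\<dots> = 16 * (energy_var / \<nu> ^ 4) / \<omega>\<^sup>2"
    using n by (simp add: power_mult_distrib power_divide ac_simps flip: power_mult)
  finally have d1: "real n * energy_var / (real s * \<nu>\<^sup>2)\<^sup>2 \<le> 16 * (energy_var / \<nu> ^ 4) / \<omega>\<^sup>2" .
  have d2: "real n * info_var / t\<^sup>2 = 16 * (info_var / capacity\<^sup>2) / \<omega>\<^sup>2"
    using n by (simp add: t_def power_mult_distrib power_divide ac_simps)
  have d3: "(real M - 1) * exp (- \<gamma>) < \<epsilon> / 2"
    using mult_strict_right_mono[OF M(3), of "exp (- \<gamma>)"]
    by (simp add: mult.assoc flip: exp_add)
  have "16 * (energy_var / \<nu> ^ 4 + info_var / capacity\<^sup>2) / \<omega>\<^sup>2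
      = 16 * (energy_var / \<nu> ^ 4) / \<omega>\<^sup>2 + 16 * (info_var / capacity\<^sup>2) / \<omega>\<^sup>2"
    by (simp add: distrib_left add_divide_distrib)
  then have "real n * energy_var / (real s * \<nu>\<^sup>2)\<^sup>2 + real n * info_var / t\<^sup>2 + (real M - 1) * exp (- \<gamma>) < \<epsilon>"
    using d1 d2 d3 large by linarith
  then have ex: "\<exists>enc dec. eh_code n M enc dec \<and> eh_error_prob D \<sigma> n M enc dec \<le> \<epsilon>"
    unfolding \<gamma>_def by (rule code_exists[OF s(3) t M(1)])
  obtain b where b: "\<forall>M. (\<exists>enc dec. eh_code n M enc dec \<and> eh_error_prob D \<sigma> n M enc dec \<le> \<epsilon>) \<longrightarrow> M \<le> b"
    using eh_code_size_bounded[OF prob_D sets_D pos \<sigma>_pos \<epsilon>(2)] by blast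
  have "M \<le> eh_max_code_size D \<sigma> n \<epsilon>"
    unfolding eh_max_code_size_def by (rule Greatest_le_nat[where b = b]) (use ex b in blast)+
  then have "\<epsilon> / 2 * exp \<gamma> \<le> real (eh_max_code_size D \<sigma> n \<epsilon>)" using M(2) by linarith
  then have "ln (\<epsilon> / 2 * exp \<gamma>) \<le> ln (real (eh_max_code_size D \<sigma> n \<epsilon>))"
    using e by (subst ln_le_cancel_iff) linarith+
  moreover have "ln (\<epsilon> / 2 * exp \<gamma>) = ln (\<epsilon> / 2) + \<gamma>"
    using \<epsilon> by (subst ln_mult) auto
  moreover have "real n * capacity - sqrt n * \<omega> * capacity / 2 - capacity \<le> \<gamma>"
  proof -
    \<comment> \<open>Truncated subtraction is harmless: \<open>real (n - s)\<close> is at least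
      \<open>real n - real s\<close> even if \<open>s\<close> exceeds \<open>n\<close>.\<close>
    have "(real n - (sqrt n * \<omega> / 4 + 1)) * capacity \<le> real (n - s) * capacity"
      using s(2) cap by (intro mult_right_mono) linarith+
    then show ?thesis by (simp add: \<gamma>_def t_def algebra_simps)
  qed
  ultimately show ?thesis by linarith
qed

text \<open>The claim allows twice the loss that \<open>max_code_size_ge\<close> incurs at this
  order. As \<open>\<omega>\<close> is unbounded, the difference eventually exceeds
  \<open>sqrt n * c\<close> plus any constant, for every fixed \<open>c\<close>.\<close>

lemma log_max_code_size_ge:
  assumes pos: "AE y in D. 0 \<le> y" and \<epsilon>: "0 < \<epsilon>" "\<epsilon> < 1" and \<omega>: "filterlim \<omega> at_top sequentially"
  shows "\<forall>\<^sub>F n in sequentially. real n * C_EG (\<nu>\<^sup>2) \<sigma> - sqrt n * \<omega> n * C_EG (\<nu>\<^sup>2) \<sigma> + sqrt n * c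
    \<le> log 2 (real (eh_max_code_size D \<sigma> n \<epsilon>))"
proof -
  let ?C = "C_EG (\<nu>\<^sup>2) \<sigma>"
  define K where "K = 16 * (energy_var / \<nu> ^ 4 + info_var / capacity\<^sup>2)"
  define A where "A = \<bar>c\<bar> + \<bar>?C - log 2 (\<epsilon> / 2)\<bar>"
  have C: "0 < ?C" using capacity_pos by (simp flip: capacity_eq)
  \<comment> \<open>The three thresholds: 1 makes \<open>\<omega> n\<close> at most its square,
    \<open>2 * K / \<epsilon>\<close> then yields the condition \<open>large\<close>, and
    \<open>2 * A / ?C\<close> lets the spare half of the loss absorb \<open>A\<close>. Constants may
    be scaled into \<open>sqrt n * A\<close> because \<open>1 \<le> sqrt n\<close>.\<close>
  have "\<forall>\<^sub>F n in sequentially. max 1 (max (2 * K / \<epsilon>) (2 * A / ?C)) \<le> \<omega> n"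
    using \<omega> unfolding filterlim_at_top by blast
  then show ?thesis using eventually_gt_at_top[of 0]
  proof eventually_elim
    case (elim n)
    then have w: "1 \<le> \<omega> n" "2 * K / \<epsilon> \<le> \<omega> n" "2 * A / ?C \<le> \<omega> n" and n: "0 < n" by auto
    have "\<omega> n \<le> (\<omega> n)\<^sup>2" using w(1) by (simp add: power2_eq_square)
    then have "2 * K / \<epsilon> \<le> (\<omega> n)\<^sup>2" using w(2) by linarith
    then have "K / (\<omega> n)\<^sup>2 \<le> \<epsilon> / 2" using w(1) \<epsilon> by (simp add: field_simps)
    then have "real n * capacity - sqrt n * \<omega> n * capacity / 2 - capacity + ln (\<epsilon> / 2)
        \<le> ln (real (eh_max_code_size D \<sigma> n \<epsilon>))"
      using w(1) by (intro max_code_size_ge pos \<epsilon> n) (simp_all add: K_def)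
    then have "(real n * capacity - sqrt n * \<omega> n * capacity / 2 - capacity + ln (\<epsilon> / 2)) / ln 2
        \<le> log 2 (real (eh_max_code_size D \<sigma> n \<epsilon>))"
      unfolding log_def by (intro divide_right_mono) auto
    also have "(real n * capacity - sqrt n * \<omega> n * capacity / 2 - capacity + ln (\<epsilon> / 2)) / ln 2
        = real n * ?C - sqrt n * \<omega> n * ?C / 2 - ?C + log 2 (\<epsilon> / 2)"
      unfolding capacity_eq[symmetric] by (simp add: log_def add_divide_distrib diff_divide_distrib)
    finally have lower: "real n * ?C - sqrt n * \<omega> n * ?C / 2 - ?C + log 2 (\<epsilon> / 2)
        \<le> log 2 (real (eh_max_code_size D \<sigma> n \<epsilon>))" .
    have rt: "1 \<le> sqrt n" using n by simp
    have "A \<le> \<omega> n * ?C / 2" using w(3) C by (simp add: field_simps)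
    then have "sqrt n * A \<le> sqrt n * (\<omega> n * ?C / 2)" by (intro mult_left_mono) auto
    moreover have "sqrt n * c + (?C - log 2 (\<epsilon> / 2)) \<le> sqrt n * A"
    proof -
      have "1 * \<bar>?C - log 2 (\<epsilon> / 2)\<bar> \<le> sqrt n * \<bar>?C - log 2 (\<epsilon> / 2)\<bar>"
        using rt by (intro mult_right_mono) auto
      moreover have "sqrt n * c \<le> sqrt n * \<bar>c\<bar>" by (intro mult_left_mono) auto
      moreover have "?C - log 2 (\<epsilon> / 2) \<le> 1 * \<bar>?C - log 2 (\<epsilon> / 2)\<bar>" by simp
      ultimately show ?thesis unfolding A_def distrib_left by (meson add_mono order_trans)
    qed
    moreover have "sqrt n * (\<omega> n * ?C / 2) = sqrt n * \<omega> n * ?C - sqrt n * \<omega> n * ?C / 2" by simp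
    ultimately show ?case using lower by linarith
  qed
qed

end

theorem theorem1:
  fixes \<Omega> :: "'a measure" and Y :: "'a \<Rightarrow> real" and \<sigma> \<epsilon> a :: real
  assumes "prob_space \<Omega>"
    and "Y \<in> borel_measurable \<Omega>"
    and "AE \<omega> in \<Omega>. 0 \<le> Y \<omega>"
    and "integrable \<Omega> (\<lambda>\<omega>. (Y \<omega>)\<^sup>2)"
    and "0 < \<sigma>"
    and "0 < \<epsilon>" and "\<epsilon> < 1"
    and "0 < a"
  defines "EY \<equiv> prob_space.expectation \<Omega> Y"
  shows "\<exists>C_hat\<ge>0. \<exists>r :: nat \<Rightarrow> real. r \<in> O[sequentially](\<lambda>_. 1) \<and>
    (\<forall>\<^sub>F n in sequentially.
       log 2 (real (eh_max_code_size (distr \<Omega> borel Y) \<sigma> n \<epsilon>)) \<ge>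
         real n * C_EG EY \<sigma>
         - sqrt (real n) * (log 2 (real n) powr a) * C_EG EY \<sigma>
         + sqrt (real n * V_EG EY \<sigma> / 2) * std_normal_quantile \<epsilon>
         - sqrt (real n) * C_hat / (log 2 (real n / 2) powr (2 * a))
         - log 2 (real n)
         + r n)"
proof -
  interpret prob_space \<Omega> by fact
  define D where "D = distr \<Omega> borel Y"
  note [measurable] = assms(2)
  note pos = assms(3)
  have "0 \<le> EY" unfolding EY_def using pos by (rule integral_nonneg_AE)
  have AE_D: "AE y in D. 0 \<le> y" unfolding D_def using pos by (subst AE_distr_iff) auto
  \<comment> \<open>The case \<open>m = 0\<close> rests on the default value of \<open>ln\<close> at
    0; the lemma can thus be applied to the maximal code size directly.\<close>
  have log_nonneg: "0 \<le> log 2 (real m)" for m :: nat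
    by (cases "m = 0") (auto simp: log_def[of _ 0])
  let ?\<omega> = "\<lambda>n. log 2 (real n) powr a"
  have "\<forall>\<^sub>F n in sequentially. log 2 (real (eh_max_code_size D \<sigma> n \<epsilon>)) \<ge>
      real n * C_EG EY \<sigma> - sqrt (real n) * ?\<omega> n * C_EG EY \<sigma>
      + sqrt (real n * V_EG EY \<sigma> / 2) * std_normal_quantile \<epsilon> - log 2 (real n)"
  proof (cases "EY = 0")
    case True
    \<comment> \<open>Here \<open>C_EG\<close> and \<open>V_EG\<close> are 0, so
      \<open>- log 2 (real n)\<close> is the whole right-hand side. The case is separate because
      \<open>gaussian_input\<close> requires positive input power.\<close>
    have "log 2 (real (eh_max_code_size D \<sigma> n \<epsilon>)) \<ge> - log 2 (real n)" for n
      using log_nonneg[of n] log_nonneg[of "eh_max_code_size D \<sigma> n \<epsilon>"] by linarith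
    then show ?thesis unfolding True by (simp add: C_EG_def V_EG_def)
  next
    case False
    then have EY: "0 < EY" using \<open>0 \<le> EY\<close> by simp
    interpret gaussian_input D "sqrt EY" \<sigma>
    proof (rule gaussian_input.intro)
      show "prob_space D" unfolding D_def by (rule prob_space_distr) measurable
      show "integrable D (\<lambda>y. y\<^sup>2)" unfolding D_def using assms(4) by (subst integrable_distr_eq) auto
      show "(\<integral>y. y \<partial>D) = (sqrt EY)\<^sup>2" unfolding D_def using EY by (subst integral_distr) (auto simp: EY_def)
    qed (use EY assms(5) in \<open>auto simp: D_def\<close>)
    have "filterlim ?\<omega> at_top sequentially" by (rule filterlim_log_powr_at_top) fact
    from log_max_code_size_ge[OF AE_D \<open>0 < \<epsilon>\<close> \<open>\<epsilon> < 1\<close> this, of "sqrt (V_EG EY \<sigma> / 2) * std_normal_quantile \<epsilon>"]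
    show ?thesis
    proof eventually_elim
      case (elim n)
      have "sqrt (real n * V_EG EY \<sigma> / 2) = sqrt (real n) * sqrt (V_EG EY \<sigma> / 2)"
        by (simp flip: real_sqrt_mult)
      then show ?case using elim log_nonneg[of n] EY by simp
    qed
  qed
  then show ?thesis
    \<comment> \<open>The bound just shown contains neither correction term, so both witnesses can
      be 0.\<close>
    by (intro exI[of _ "0::real"] exI[of _ "\<lambda>_. 0::real"] conjI) (simp_all add: D_def)
qed

end
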